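(* Let $\Psi,\rho,\omega:\mathrm{QSym}\to\mathrm{QSym}$ be the linear maps with $\Psi(F_\alpha)=F_{\alpha^c}$, $\rho(F_\alpha)=F_{\alpha^r}$ and $\omega(F_\alpha)=F_{\alpha^t}$ for every composition $\alpha$. Then $\Psi$, $\rho$ and $\omega$ are the only nontrivial (i.e. non-identity) graded algebra automorphisms of $\mathrm{QSym}$ that take the fundamental basis $\{F_\alpha:\alpha\in\mathcal{C}\}$ onto itself. (That is, these three maps are such automorphisms, and every such automorphism other than the identity is one of them.)
   Context: A composition is a finite (possibly empty) ordered list $\alpha=(\alpha_1,\dots,\alpha_k)$ of positive integers; $|\alpha|=\alpha_1+\cdots+\alpha_k$, and $\mathcal{C}$ is the set of all compositions ($\emptyset$ is the empty one). The reversal is $\alpha^r=(\alpha_k,\dots,\alpha_1)$. For a composition $\alpha$ of $n\ge1$ let $\mathrm{Set}(\alpha)=\{\alpha_1,\alpha_1+\alpha_2,\dots,\alpha_1+\cdots+\alpha_{k-1}\}\subseteq\{1,\dots,n-1\}$; this is a bijection between compositions of $n$ and subsets of $\{1,\dots,n-1\}$. The complement $\alpha^c$ is the composition of $n$ with $\mathrm{Set}(\alpha^c)=\{1,\dots,n-1\}\setminus\mathrm{Set}(\alpha)$, and $\emptyset^c=\emptyset$. The transpose is $\alpha^t=(\alpha^r)^c=(\alpha^c)^r$. $\mathrm{QSym}$ is the set of bounded-degree formal power series $f\in\mathbb{Q}[[x_1,x_2,\dots]]$ such that for each composition $(\alpha_1,\dots,\alpha_k)$ all monomials $x_{i_1}^{\alpha_1}\cdots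 x_{i_k}^{\alpha_k}$ with $i_1<\cdots<i_k$ have the same coefficient in $f$; it is a graded subalgebra of the power series algebra. Let $M_\emptyset=1$, $M_\alpha=\sum_{i_1<\cdots<i_k}x_{i_1}^{\alpha_1}\cdots x_{i_k}^{\alpha_k}$. Write $\beta\preceq\alpha$ if $\alpha$ is obtained from $\beta$ by summing some consecutive parts of $\beta$. The fundamental basis is $F_\emptyset=1$, $F_\alpha=\sum_{\beta\preceq\alpha}M_\beta$. $\mathrm{QSym}=\bigoplus_{n\ge0}\mathrm{QSym}_n$ with $\mathrm{QSym}_n=\mathrm{span}\{F_\alpha:|\alpha|=n\}$. A map is graded if it maps $\mathrm{QSym}_n$ into $\mathrm{QSym}_n$ for all $n$. *)

theory Defs
  imports Complex_Main "HOL-Library.Poly_Mapping"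
begin

section \<open>Compositions\<close>

definition compositions :: "nat list set" where
  "compositions = {\<alpha>. \<forall>a\<in>set \<alpha>. 0 < a}"

definition comp_set :: "nat list \<Rightarrow> nat set" where
  "comp_set \<alpha> = {sum_list (take i \<alpha>) | i. 1 \<le> i \<and> i < length \<alpha>}"

text \<open>The reversal is \<^const>\<open>rev\<close>. For the empty composition
  the description below singles out the empty list.\<close>

definition complement :: "nat list \<Rightarrow> nat list" where
  "complement \<alpha> = (THE \<beta>. \<beta> \<in> compositions \<and> sum_list \<beta> = sum_list \<alpha> \<and>
                        comp_set \<beta> = {1..<sum_list \<alpha>} - comp_set \<alpha>)"

definition transpose_comp :: "nat list \<Rightarrow> nat list" where
  "transpose_comp \<alpha> = complement (rev \<alpha>)"

text \<open>\<open>\<alpha>\<close> arises from \<open>\<beta>\<close> by summing the consecutive nonempty blocks \<open>bs\<close> of \<open>\<beta>\<close>.\<close>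

definition refines :: "nat list \<Rightarrow> nat list \<Rightarrow> bool" (infix "\<preceq>" 50) where
  "\<beta> \<preceq> \<alpha> \<longleftrightarrow> (\<exists>bs. [] \<notin> set bs \<and> concat bs = \<beta> \<and> map sum_list bs = \<alpha>)"

lemma comp_set_Nil [simp]: "comp_set [] = {}"
  by (simp add: comp_set_def)

lemma comp_set_singleton [simp]: "comp_set [a] = {}"
  by (auto simp: comp_set_def)

lemma comp_set_Cons:
  assumes "\<alpha> \<noteq> []"
  shows "comp_set (a # \<alpha>) = insert a ((+) a ` comp_set \<alpha>)"
proof (intro set_eqI iffI)
  fix x assume "x \<in> comp_set (a # \<alpha>)"
  then obtain i where i: "1 \<le> i" "i < Suc (length \<alpha>)" "x = sum_list (take i (a # \<alpha>))"
    by (auto simp: comp_set_def)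
  then obtain j where j: "i = Suc j" by (cases i) auto
  show "x \<in> insert a ((+) a ` comp_set \<alpha>)"
  proof (cases j)
    case 0 then show ?thesis using i j by simp
  next
    case (Suc k)
    have "sum_list (take j \<alpha>) \<in> comp_set \<alpha>"
      unfolding comp_set_def using i j Suc by auto
    then show ?thesis using i j by auto
  qed
next
  fix x assume "x \<in> insert a ((+) a ` comp_set \<alpha>)"
  then consider "x = a" | i where "1 \<le> i" "i < length \<alpha>" "x = a + sum_list (take i \<alpha>)"
    by (auto simp: comp_set_def)
  then show "x \<in> comp_set (a # \<alpha>)"
  proof cases
    case 1
    then show ?thesis unfolding comp_set_def
      using assms by (auto intro!: exI[of _ 1])
  next
    case 2
    then show ?thesis unfolding comp_set_def by (auto intro!: exI[of _ "Suc i"])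
  qed
qed

lemma comp_set_subset:
  assumes "\<alpha> \<in> compositions" shows "comp_set \<alpha> \<subseteq> {1..<sum_list \<alpha>}"
  using assms
proof (induction \<alpha>)
  case (Cons a \<alpha>)
  then have 1: "comp_set \<alpha> \<subseteq> {1..<sum_list \<alpha>}" and a: "0 < a"
    by (auto simp: compositions_def)
  show ?case
  proof (cases \<alpha>)
    case (Cons b \<beta>)
    then have "0 < sum_list \<alpha>" using \<open>a # \<alpha> \<in> compositions\<close> by (auto simp: compositions_def)
    then show ?thesis using 1 a Cons by (auto simp: comp_set_Cons)
  qed simp
qed simp

lemma comp_set_inj:
  assumes "\<alpha> \<in> compositions" "\<beta> \<in> compositions"
    and "sum_list \<alpha> = sum_list \<beta>" "comp_set \<alpha> = comp_set \<beta>"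
  shows "\<alpha> = \<beta>"
  using assms
proof (induction \<alpha> arbitrary: \<beta>)
  case Nil
  then show ?case by (cases \<beta>) (auto simp: compositions_def)
next
  case (Cons a \<alpha>)
  have a: "0 < a" and \<alpha>: "\<alpha> \<in> compositions" using Cons.prems by (auto simp: compositions_def)
  obtain b \<gamma> where \<beta>: "\<beta> = b # \<gamma>" using Cons.prems a by (cases \<beta>) auto
  have b: "0 < b" and \<gamma>: "\<gamma> \<in> compositions" using Cons.prems \<beta> by (auto simp: compositions_def)
  show ?case
  proof (cases "\<alpha> = [] \<or> \<gamma> = []")
    case True
    have "\<alpha> = [] \<and> \<gamma> = []"
    proof (rule ccontr)
      assume "\<not> (\<alpha> = [] \<and> \<gamma> = [])"
      then consider "\<alpha> = []" "\<gamma> \<noteq> []" | "\<alpha> \<noteq> []" "\<gamma> = []" using True by blast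
      then show False using Cons.prems(4) \<beta> by cases (simp_all add: comp_set_Cons)
    qed
    then show ?thesis using Cons.prems(3) \<beta> by simp
  next
    case False
    have lb: "\<And>\<delta> x. \<delta> \<in> compositions \<Longrightarrow> x \<in> comp_set \<delta> \<Longrightarrow> 0 < x"
      using comp_set_subset by fastforce
    have eq: "insert a ((+) a ` comp_set \<alpha>) = insert b ((+) b ` comp_set \<gamma>)"
      using Cons.prems False \<beta> by (simp add: comp_set_Cons)
    have "a \<in> insert b ((+) b ` comp_set \<gamma>)" "b \<in> insert a ((+) a ` comp_set \<alpha>)"
      using eq by blast+
    then have ab: "a = b" by auto
    have n: "a \<notin> (+) a ` comp_set \<alpha>" "a \<notin> (+) a ` comp_set \<gamma>"
      using lb[OF \<alpha>, of 0] lb[OF \<gamma>, of 0] by auto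
    then have "(+) a ` comp_set \<alpha> = (+) a ` comp_set \<gamma>"
      using insert_ident[of a] eq unfolding ab by metis
    then have "comp_set \<alpha> = comp_set \<gamma>" by (simp add: inj_image_eq_iff)
    then show ?thesis using Cons.IH[OF \<alpha> \<gamma>] Cons.prems \<beta> ab by simp
  qed
qed

lemma comp_set_surj:
  assumes "S \<subseteq> {1..<n}"
  shows "\<exists>\<beta>. \<beta> \<in> compositions \<and> sum_list \<beta> = n \<and> comp_set \<beta> = S"
  using assms
proof (induction n arbitrary: S rule: less_induct)
  case (less n)
  show ?case
  proof (cases "S = {}")
    case True
    show ?thesis
    proof (cases "n = 0")
      case True
      then show ?thesis using \<open>S = {}\<close> by (intro exI[of _ "[]"]) (simp add: compositions_def)
    next
      case False
      then show ?thesis using \<open>S = {}\<close> by (intro exI[of _ "[n]"]) (simp add: compositions_def)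
    qed
  next
    case False
    have fin: "finite S" using less.prems finite_subset by blast
    define a where "a = Min S"
    have aS: "a \<in> S" and amin: "\<And>x. x \<in> S \<Longrightarrow> a \<le> x" using fin False by (auto simp: a_def)
    have a: "1 \<le> a" "a < n" using aS less.prems by auto
    define T where "T = (\<lambda>x. x - a) ` (S - {a})"
    have T: "T \<subseteq> {1..<n - a}"
      unfolding T_def using less.prems amin a by (fastforce simp: le_neq_implies_less)
    have S: "S = insert a ((+) a ` T)"
      unfolding T_def using aS amin by (force simp: image_image)
    obtain \<gamma> where \<gamma>: "\<gamma> \<in> compositions" "sum_list \<gamma> = n - a" "comp_set \<gamma> = T"
      using less.IH[of "n - a" T] T a by auto
    then have "\<gamma> \<noteq> []" using a by auto
    then show ?thesis using \<gamma> a S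
      by (intro exI[of _ "a # \<gamma>"]) (auto simp: compositions_def comp_set_Cons)
  qed
qed

text \<open>The description in \<^const>\<open>complement\<close> is always met by exactly one list.\<close>

lemma complement_unique:
  "\<exists>!\<beta>. \<beta> \<in> compositions \<and> sum_list \<beta> = sum_list \<alpha> \<and>
        comp_set \<beta> = {1..<sum_list \<alpha>} - comp_set \<alpha>"
  using comp_set_surj[of "{1..<sum_list \<alpha>} - comp_set \<alpha>" "sum_list \<alpha>"] comp_set_inj
  by (metis (no_types, lifting) Diff_subset)


section \<open>Formal power series over \<open>\<rat>\<close> in countably many variables\<close>

text \<open>A monomial is its finitely supported exponent function. The variables are indexed by
  \<open>0, 1, 2, \<dots>\<close> instead of \<open>1, 2, 3, \<dots>\<close>.\<close>

type_synonym monomial = "nat \<Rightarrow>\<^sub>0 nat"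

definition mdeg :: "monomial \<Rightarrow> nat" where
  "mdeg m = (\<Sum>i\<in>Poly_Mapping.keys m. Poly_Mapping.lookup m i)"

text \<open>\<open>mon [i\<^sub>1, \<dots>, i\<^sub>k] [a\<^sub>1, \<dots>, a\<^sub>k]\<close> is the product of the powers of the
  variables \<open>i\<^sub>1, \<dots>, i\<^sub>k\<close> with exponents \<open>a\<^sub>1, \<dots>, a\<^sub>k\<close>
  (monomials are written additively).\<close>

definition mon :: "nat list \<Rightarrow> nat list \<Rightarrow> monomial" where
  "mon is \<alpha> = sum_list (map2 Poly_Mapping.single is \<alpha>)"

typedef power_series = "UNIV :: (monomial \<Rightarrow> rat) set"
  morphisms coeff Power_Series ..

setup_lifting type_definition_power_series

lemma power_series_eqI: "(\<And>m. coeff f m = coeff g m) \<Longrightarrow> f = g"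
  by transfer auto

lemma finite_splittings: "finite {(a, b :: monomial). a + b = m}"
proof -
  define K where "K = Poly_Mapping.keys m"
  define N where "N = mdeg m"
  have le: "Poly_Mapping.lookup m i \<le> N" for i
    unfolding N_def mdeg_def
    by (cases "i \<in> Poly_Mapping.keys m")
       (auto intro: member_le_sum simp: in_keys_iff)
  have fin: "finite {h :: nat \<Rightarrow> nat. (\<forall>i. (i \<in> K \<longrightarrow> h i \<in> {..N}) \<and> (i \<notin> K \<longrightarrow> h i = 0))}"
    by (rule finite_set_of_finite_funs) (auto simp: K_def)
  have "Poly_Mapping.lookup ` {a. \<exists>b. a + b = m} \<subseteq>
        {h. (\<forall>i. (i \<in> K \<longrightarrow> h i \<in> {..N}) \<and> (i \<notin> K \<longrightarrow> h i = 0))}"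
  proof safe
    fix a b i assume "m = a + b"
    then have *: "Poly_Mapping.lookup a i \<le> Poly_Mapping.lookup m i" by (simp add: lookup_add)
    then show "Poly_Mapping.lookup a i \<le> N" using le[of i] by simp
    show "i \<notin> K \<Longrightarrow> Poly_Mapping.lookup a i = 0"
      using * by (simp add: K_def in_keys_iff)
  qed
  then have "finite (Poly_Mapping.lookup ` {a. \<exists>b. a + b = m})"
    using fin finite_subset by blast
  then have "finite {a. \<exists>b. a + b = m}"
    by (rule finite_imageD) (auto simp: inj_on_def poly_mapping_eqI)
  then have "finite ((\<lambda>a. (a, m - a)) ` {a. \<exists>b. a + b = m})" by simp
  then show ?thesis
    by (rule rev_finite_subset) auto
qed

instantiation power_series :: comm_ring_1
begin

lift_definition zero_power_series :: power_series is "\<lambda>_. 0" .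
lift_definition one_power_series :: power_series is "\<lambda>m. if m = 0 then 1 else 0" .
lift_definition plus_power_series :: "power_series \<Rightarrow> power_series \<Rightarrow> power_series"
  is "\<lambda>f g m. f m + g m" .
lift_definition uminus_power_series :: "power_series \<Rightarrow> power_series" is "\<lambda>f m. - f m" .
lift_definition minus_power_series :: "power_series \<Rightarrow> power_series \<Rightarrow> power_series"
  is "\<lambda>f g m. f m - g m" .
lift_definition times_power_series :: "power_series \<Rightarrow> power_series \<Rightarrow> power_series"
  is "\<lambda>f g m. \<Sum>(a, b) | a + b = m. f a * g b" .

instance
proof
  fix f g h :: power_series
  show "f + g + h = f + (g + h)" "f + g = g + f" "0 + f = f" "- f + f = 0" "f - g = f + - g"
    by (transfer; auto)+
  show "(0::power_series) \<noteq> 1"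
    by transfer (auto simp: fun_eq_iff)
  show "f * g = g * f"
    by transfer
       (rule ext, rule sum.reindex_bij_witness[of _ "\<lambda>(a, b). (b, a)" "\<lambda>(a, b). (b, a)"];
        auto simp: add.commute)
  show "(f + g) * h = f * h + g * h"
    by transfer (simp add: sum.distrib[symmetric] case_prod_beta distrib_right)
  show "1 * f = f"
  proof (transfer, rule ext)
    fix f :: "monomial \<Rightarrow> rat" and m :: monomial
    have "(\<Sum>(a, b) | a + b = m. (if a = 0 then 1 else 0) * f b) =
          (\<Sum>(a, b)\<in>{(0 :: monomial, m)}. (if a = 0 then 1 else 0) * f b)"
      by (rule sum.mono_neutral_right[OF finite_splittings]) (auto split: if_splits)
    then show "(\<Sum>(a, b) | a + b = m. (if a = 0 then 1 else 0) * f b) = f m" by simp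
  qed
  show "f * g * h = f * (g * h)"
  proof (transfer, rule ext)
    fix f g h :: "monomial \<Rightarrow> rat" and m :: monomial
    let ?S = "\<lambda>p :: monomial. {(a, b). a + b = p}"
    have "(\<Sum>(p, c)\<in>?S m. (\<Sum>(a, b)\<in>?S p. f a * g b) * h c) =
          (\<Sum>x\<in>?S m. \<Sum>y\<in>?S (fst x). f (fst y) * g (snd y) * h (snd x))"
      by (simp add: case_prod_beta sum_distrib_right)
    also have "\<dots> = (\<Sum>(x, y)\<in>(SIGMA x:?S m. ?S (fst x)). f (fst y) * g (snd y) * h (snd x))"
      by (rule sum.Sigma) (auto simp: finite_splittings)
    also have "\<dots> = (\<Sum>(x, y)\<in>(SIGMA x:?S m. ?S (snd x)). f (fst x) * (g (fst y) * h (snd y)))"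
      by (rule sum.reindex_bij_witness[of _
            "\<lambda>((a, q), (b, c)). ((a + b, c), (a, b))" "\<lambda>((p, c), (a, b)). ((a, b + c), (b, c))"])
         (auto simp: add.assoc mult.assoc)
    also have "\<dots> = (\<Sum>x\<in>?S m. \<Sum>y\<in>?S (snd x). f (fst x) * (g (fst y) * h (snd y)))"
      by (rule sum.Sigma[symmetric]) (auto simp: finite_splittings)
    also have "\<dots> = (\<Sum>(a, q)\<in>?S m. f a * (\<Sum>(b, c)\<in>?S q. g b * h c))"
      by (simp add: case_prod_beta sum_distrib_left)
    finally show "(\<Sum>(p, c)\<in>?S m. (\<Sum>(a, b)\<in>?S p. f a * g b) * h c) =
                  (\<Sum>(a, q)\<in>?S m. f a * (\<Sum>(b, c)\<in>?S q. g b * h c))" .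
  qed
qed

end


section \<open>Quasisymmetric functions\<close>

definition bounded_degree :: "power_series \<Rightarrow> bool" where
  "bounded_degree f \<longleftrightarrow> (\<exists>d. \<forall>m. coeff f m \<noteq> 0 \<longrightarrow> mdeg m \<le> d)"

definition quasisymmetric :: "power_series \<Rightarrow> bool" where
  "quasisymmetric f \<longleftrightarrow>
     (\<forall>\<alpha>\<in>compositions. \<forall>is js.
        sorted_wrt (<) is \<and> length is = length \<alpha> \<and> sorted_wrt (<) js \<and> length js = length \<alpha> \<longrightarrow>
        coeff f (mon is \<alpha>) = coeff f (mon js \<alpha>))"

lemma mdeg_superset:
  assumes "finite A" "Poly_Mapping.keys m \<subseteq> A"
  shows "mdeg m = sum (Poly_Mapping.lookup m) A"
  unfolding mdeg_def using assms
  by (intro sum.mono_neutral_left) (auto simp: in_keys_iff)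

lemma mdeg_zero [simp]: "mdeg 0 = 0"
  by (simp add: mdeg_def)

lemma mdeg_add: "mdeg (a + b) = mdeg a + mdeg b"
proof -
  let ?A = "Poly_Mapping.keys a \<union> Poly_Mapping.keys b"
  have "mdeg (a + b) = sum (Poly_Mapping.lookup (a + b)) ?A"
    by (rule mdeg_superset) (auto simp: Poly_Mapping.keys_add)
  also have "\<dots> = sum (Poly_Mapping.lookup a) ?A + sum (Poly_Mapping.lookup b) ?A"
    by (simp add: lookup_add sum.distrib)
  also have "\<dots> = mdeg a + mdeg b"
    using mdeg_superset[of ?A a] mdeg_superset[of ?A b] by simp
  finally show ?thesis .
qed

lemma mdeg_single [simp]: "mdeg (Poly_Mapping.single i e) = e"
  by (subst mdeg_superset[of "{i}"]) auto

lemma mon_Nil [simp]: "mon [] \<alpha> = 0" "mon is [] = 0"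
  by (simp_all add: mon_def)

lemma mon_Cons [simp]: "mon (i # is) (a # \<alpha>) = Poly_Mapping.single i a + mon is \<alpha>"
  by (simp add: mon_def)

lemma mdeg_mon: "length is = length \<alpha> \<Longrightarrow> mdeg (mon is \<alpha>) = sum_list \<alpha>"
  by (induction "is" \<alpha> rule: list_induct2) (auto simp: mdeg_add)

lemma mon_add:
  "\<lbrakk>length is = length u; length u = length v\<rbrakk> \<Longrightarrow> mon is (map2 (+) u v) = mon is u + mon is v"
  by (induction "is" u v rule: list_induct3) (auto simp: single_add algebra_simps)

lemma keys_mon: "Poly_Mapping.keys (mon is \<alpha>) \<subseteq> set is"
proof (induction "is" arbitrary: \<alpha>)
  case (Cons i "is")
  then show ?case
    by (cases \<alpha>) (auto dest!: subsetD[OF Poly_Mapping.keys_add] split: if_splits)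
qed simp

lemma lookup_mon_notin: "i \<notin> set is \<Longrightarrow> Poly_Mapping.lookup (mon is \<alpha>) i = 0"
  using keys_mon[of "is" \<alpha>] by (auto simp: in_keys_iff)

lemma map_lookup_mon:
  "\<lbrakk>length is = length \<alpha>; distinct is\<rbrakk> \<Longrightarrow> map (Poly_Mapping.lookup (mon is \<alpha>)) is = \<alpha>"
proof (induction "is" \<alpha> rule: list_induct2)
  case (Cons i "is" a \<alpha>)
  have "map (Poly_Mapping.lookup (mon (i # is) (a # \<alpha>))) is = map (Poly_Mapping.lookup (mon is \<alpha>)) is"
    using Cons.prems by (intro map_cong) (auto simp: lookup_add lookup_single when_def)
  moreover have "Poly_Mapping.lookup (mon (i # is) (a # \<alpha>)) i = a"
    using Cons.prems by (simp add: lookup_add lookup_mon_notin)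
  ultimately show ?case using Cons.IH Cons.prems by (simp only: list.map distinct.simps)
qed simp

lemma mon_map_lookup:
  assumes "distinct is" "Poly_Mapping.keys m \<subseteq> set is"
  shows "mon is (map (Poly_Mapping.lookup m) is) = m"
proof (rule poly_mapping_eqI)
  fix i
  have "map (Poly_Mapping.lookup (mon is (map (Poly_Mapping.lookup m) is))) is =
        map (Poly_Mapping.lookup m) is"
    using assms by (intro map_lookup_mon) auto
  then have "i \<in> set is \<Longrightarrow>
      Poly_Mapping.lookup (mon is (map (Poly_Mapping.lookup m) is)) i = Poly_Mapping.lookup m i"
    by simp
  moreover have "i \<notin> set is \<Longrightarrow> Poly_Mapping.lookup m i = 0"
    using assms by (auto simp: in_keys_iff)
  ultimately show "Poly_Mapping.lookup (mon is (map (Poly_Mapping.lookup m) is)) i =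
      Poly_Mapping.lookup m i"
    by (cases "i \<in> set is") (auto simp: lookup_mon_notin)
qed

lemma sorted_wrt_less_distinct: "sorted_wrt (<) (is :: nat list) \<Longrightarrow> distinct is"
  by (simp add: strict_sorted_iff)

lemma mon_filter:
  "length is = length u \<Longrightarrow>
     mon is u = mon (map fst (filter (\<lambda>x. snd x \<noteq> 0) (zip is u))) (filter (\<lambda>e. e \<noteq> 0) u)"
  by (induction "is" u rule: list_induct2) auto

lemma length_filter_zip:
  "length is = length u \<Longrightarrow>
     length (filter (\<lambda>x. snd x \<noteq> (0::nat)) (zip is u)) = length (filter (\<lambda>e. e \<noteq> 0) u)"
  by (induction "is" u rule: list_induct2) auto

lemma sorted_filter_zip:
  "\<lbrakk>length is = length u; sorted_wrt (<) (is :: nat list)\<rbrakk> \<Longrightarrow>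
     sorted_wrt (<) (map fst (filter (\<lambda>x. snd x \<noteq> (0::nat)) (zip is u)))"
  by (induction "is" u rule: list_induct2) (auto dest: set_zip_leftD)

lemma quasisymmetricD:
  assumes "quasisymmetric f" "\<alpha> \<in> compositions"
    and "sorted_wrt (<) is" "length is = length \<alpha>" "sorted_wrt (<) js" "length js = length \<alpha>"
  shows "coeff f (mon is \<alpha>) = coeff f (mon js \<alpha>)"
  using assms unfolding quasisymmetric_def by blast

lemma quasisymmetric_weak:
  assumes "quasisymmetric f"
    and "sorted_wrt (<) is" "length is = length u" "sorted_wrt (<) js" "length js = length u"
  shows "coeff f (mon is u) = coeff f (mon js u)"
  unfolding mon_filter[OF assms(3)] mon_filter[OF assms(5)]
proof (rule quasisymmetricD[OF assms(1)])
  show "filter (\<lambda>e. e \<noteq> 0) u \<in> compositions" by (auto simp: compositions_def)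
qed (use assms in \<open>simp_all only: sorted_filter_zip length_filter_zip length_map\<close>)

lemma quasisymmetric_mult:
  assumes f: "quasisymmetric f" and g: "quasisymmetric g"
  shows "quasisymmetric (f * g)"
proof -
  have key: "coeff (f * g) (mon is \<alpha>) =
      (\<Sum>(u, v) | length u = length \<alpha> \<and> length v = length \<alpha> \<and> map2 (+) u v = \<alpha>.
         coeff f (mon is u) * coeff g (mon is v))"
    if s: "sorted_wrt (<) is" and l: "length is = length \<alpha>" for "is" \<alpha>
  proof -
    have d: "distinct is" using s by (rule sorted_wrt_less_distinct)
    let ?L = "\<lambda>m. map (Poly_Mapping.lookup m) is"
    have "(\<Sum>(a, b) | a + b = mon is \<alpha>. coeff f a * coeff g b) =
      (\<Sum>(u, v) | length u = length \<alpha> \<and> length v = length \<alpha> \<and> map2 (+) u v = \<alpha>.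
         coeff f (mon is u) * coeff g (mon is v))"
    proof (rule sum.reindex_bij_witness[of _
            "\<lambda>(u, v). (mon is u, mon is v)" "\<lambda>(a, b). (?L a, ?L b)"], goal_cases)
      case (1 x)
      obtain a b where x: "x = (a, b)" by (cases x)
      have ab: "a + b = mon is \<alpha>" using 1 x by simp
      have "Poly_Mapping.lookup (mon is \<alpha>) i = Poly_Mapping.lookup a i + Poly_Mapping.lookup b i" for i
        using ab by (metis lookup_add)
      then have "Poly_Mapping.keys a \<subseteq> set is" "Poly_Mapping.keys b \<subseteq> set is"
        using keys_mon[of "is" \<alpha>] by (auto simp: in_keys_iff subset_iff)
      then show ?case using x d by (simp add: mon_map_lookup)
    next
      case (2 x)
      obtain a b where x: "x = (a, b)" by (cases x)
      have ab: "a + b = mon is \<alpha>" using 2 x by simp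
      have "map2 (+) (?L a) (?L b) = ?L (a + b)"
        by (simp add: lookup_add map2_map_map)
      also have "\<dots> = \<alpha>" using ab l d by (simp add: map_lookup_mon)
      finally show ?case using x l by simp
    next
      case (3 y)
      then obtain u v where "y = (u, v)" "length is = length u" "length is = length v"
        using l by (cases y) simp
      then show ?case using d by (simp add: map_lookup_mon)
    next
      case (4 y)
      then obtain u v where "y = (u, v)" "length is = length u" "length u = length v"
        "map2 (+) u v = \<alpha>"
        using l by (cases y) simp
      then show ?case using mon_add[of "is" u v] by simp
    next
      case (5 x)
      obtain a b where x: "x = (a, b)" by (cases x)
      have ab: "a + b = mon is \<alpha>" using 5 x by simp
      have "Poly_Mapping.lookup (mon is \<alpha>) i = Poly_Mapping.lookup a i + Poly_Mapping.lookup b i" for i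
        using ab by (metis lookup_add)
      then have "Poly_Mapping.keys a \<subseteq> set is" "Poly_Mapping.keys b \<subseteq> set is"
        using keys_mon[of "is" \<alpha>] by (auto simp: in_keys_iff subset_iff)
      then show ?case using x d by (simp add: mon_map_lookup)
    qed
    then show ?thesis by (simp add: times_power_series.rep_eq)
  qed
  show ?thesis
    unfolding quasisymmetric_def
  proof (intro ballI allI impI, elim conjE)
    fix \<alpha> "is" js :: "nat list"
    assume i: "sorted_wrt (<) is" "length is = length \<alpha>"
      and j: "sorted_wrt (<) js" "length js = length \<alpha>"
    show "coeff (f * g) (mon is \<alpha>) = coeff (f * g) (mon js \<alpha>)"
      unfolding key[OF i] key[OF j]
    proof (rule sum.cong[OF refl], goal_cases)
      case (1 x)
      then obtain u v where x: "x = (u, v)" and l: "length u = length \<alpha>" "length v = length \<alpha>"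
        by blast
      have "coeff f (mon is u) = coeff f (mon js u)" "coeff g (mon is v) = coeff g (mon js v)"
        using i j l by (auto intro: quasisymmetric_weak f g)
      then show ?case by (simp add: x)
    qed
  qed
qed

lemma bounded_degree_mult:
  assumes "bounded_degree f" "bounded_degree g" shows "bounded_degree (f * g)"
proof -
  obtain d e where d: "\<And>m. coeff f m \<noteq> 0 \<Longrightarrow> mdeg m \<le> d" and e: "\<And>m. coeff g m \<noteq> 0 \<Longrightarrow> mdeg m \<le> e"
    using assms by (auto simp: bounded_degree_def)
  have "mdeg m \<le> d + e" if "coeff (f * g) m \<noteq> 0" for m
  proof -
    have "\<exists>x\<in>{(a, b). a + b = m}. (case x of (a, b) \<Rightarrow> coeff f a * coeff g b) \<noteq> 0"
      using that by (metis (no_types, lifting) sum.neutral times_power_series.rep_eq)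
    then obtain a b where "a + b = m" "coeff f a \<noteq> 0" "coeff g b \<noteq> 0" by auto
    then show ?thesis using d[of a] e[of b] by (auto simp: mdeg_add)
  qed
  then show ?thesis by (auto simp: bounded_degree_def)
qed

lemma bounded_degree_add:
  assumes "bounded_degree f" "bounded_degree g" shows "bounded_degree (f + g)"
proof -
  obtain d e where d: "\<And>m. coeff f m \<noteq> 0 \<Longrightarrow> mdeg m \<le> d" and e: "\<And>m. coeff g m \<noteq> 0 \<Longrightarrow> mdeg m \<le> e"
    using assms by (auto simp: bounded_degree_def)
  have "mdeg m \<le> max d e" if "coeff (f + g) m \<noteq> 0" for m
    using that d[of m] e[of m] by (cases "coeff f m = 0") (auto simp: plus_power_series.rep_eq)
  then show ?thesis by (auto simp: bounded_degree_def)
qed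

typedef qsym = "{f. bounded_degree f \<and> quasisymmetric f}"
  morphisms series_of QSym
  by (rule exI[of _ 0]) (auto simp: bounded_degree_def quasisymmetric_def zero_power_series.rep_eq)

setup_lifting type_definition_qsym

lemma quasisymmetric_uminus:
  assumes "quasisymmetric f" shows "quasisymmetric (- f)"
  unfolding quasisymmetric_def uminus_power_series.rep_eq
  using quasisymmetricD[OF assms] by (intro ballI allI impI arg_cong[of _ _ uminus]) blast

lemma quasisymmetric_add:
  assumes "quasisymmetric f" "quasisymmetric g" shows "quasisymmetric (f + g)"
  unfolding quasisymmetric_def plus_power_series.rep_eq
  using quasisymmetricD[OF assms(1)] quasisymmetricD[OF assms(2)]
  by (intro ballI allI impI arg_cong2[of _ _ _ _ "(+)"]) blast+

lemma bounded_degree_uminus: "bounded_degree f \<Longrightarrow> bounded_degree (- f)"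
  by (auto simp: bounded_degree_def uminus_power_series.rep_eq)

lemma mon_eq_0_iff:
  assumes "\<alpha> \<in> compositions" "length is = length \<alpha>"
  shows "mon is \<alpha> = 0 \<longleftrightarrow> \<alpha> = []"
proof
  assume "mon is \<alpha> = 0"
  then have "sum_list \<alpha> = 0" using mdeg_mon[OF assms(2)] by simp
  then show "\<alpha> = []" using assms(1) by (cases \<alpha>) (auto simp: compositions_def)
qed simp

instantiation qsym :: comm_ring_1
begin

lift_definition zero_qsym :: qsym is 0
  by (auto simp: bounded_degree_def quasisymmetric_def zero_power_series.rep_eq)

lift_definition one_qsym :: qsym is 1
  by (auto simp: bounded_degree_def quasisymmetric_def one_power_series.rep_eq mon_eq_0_iff)

lift_definition plus_qsym :: "qsym \<Rightarrow> qsym \<Rightarrow> qsym" is "(+)"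
  by (auto simp: bounded_degree_add quasisymmetric_add)

lift_definition uminus_qsym :: "qsym \<Rightarrow> qsym" is uminus
  by (auto simp: bounded_degree_uminus quasisymmetric_uminus)

lift_definition minus_qsym :: "qsym \<Rightarrow> qsym \<Rightarrow> qsym" is "(-)"
  using bounded_degree_add bounded_degree_uminus quasisymmetric_add quasisymmetric_uminus
  by (metis diff_conv_add_uminus)

lift_definition times_qsym :: "qsym \<Rightarrow> qsym \<Rightarrow> qsym" is "(*)"
  by (auto simp: bounded_degree_mult quasisymmetric_mult)

instance
  by standard (transfer; simp add: algebra_simps)+

end

lift_definition series_scale :: "rat \<Rightarrow> power_series \<Rightarrow> power_series"
  is "\<lambda>c f m. c * f m" .

lemma quasisymmetric_scale:
  assumes "quasisymmetric f" shows "quasisymmetric (series_scale c f)"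
  unfolding quasisymmetric_def series_scale.rep_eq
  using quasisymmetricD[OF assms] by (intro ballI allI impI arg_cong[of _ _ "(*) c"]) blast

lemma bounded_degree_scale: "bounded_degree f \<Longrightarrow> bounded_degree (series_scale c f)"
  by (auto simp: bounded_degree_def series_scale.rep_eq)

lift_definition qsym_scale :: "rat \<Rightarrow> qsym \<Rightarrow> qsym" is series_scale
  by (simp add: quasisymmetric_scale bounded_degree_scale)

global_interpretation qsym: vector_space qsym_scale
  defines qsym_span = qsym.span
  by standard
     (transfer; rule power_series_eqI;
      simp add: series_scale.rep_eq plus_power_series.rep_eq algebra_simps)+


section \<open>The monomial and the fundamental basis\<close>

lemma mon_inj:
  assumes "\<alpha> \<in> compositions" "\<beta> \<in> compositions"
    and "sorted_wrt (<) is" "length is = length \<alpha>" "sorted_wrt (<) js" "length js = length \<beta>"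
    and "mon is \<alpha> = mon js \<beta>"
  shows "\<alpha> = \<beta>"
proof -
  have *: "set ks = Poly_Mapping.keys (mon ks \<gamma>)"
    if "\<gamma> \<in> compositions" "sorted_wrt (<) ks" "length ks = length \<gamma>" for ks \<gamma>
  proof
    have m: "map (Poly_Mapping.lookup (mon ks \<gamma>)) ks = \<gamma>"
      using that by (intro map_lookup_mon sorted_wrt_less_distinct)
    show "set ks \<subseteq> Poly_Mapping.keys (mon ks \<gamma>)"
    proof
      fix k assume "k \<in> set ks"
      then have "Poly_Mapping.lookup (mon ks \<gamma>) k \<in> set (map (Poly_Mapping.lookup (mon ks \<gamma>)) ks)"
        by simp
      then have "Poly_Mapping.lookup (mon ks \<gamma>) k \<in> set \<gamma>" by (simp only: m)
      then show "k \<in> Poly_Mapping.keys (mon ks \<gamma>)"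
        using that(1) by (auto simp: in_keys_iff compositions_def)
    qed
  qed (rule keys_mon)
  have "set is = set js" using *[of \<alpha> "is"] *[of \<beta> js] assms by simp
  then have "is = js" using assms(3,5) strict_sorted_equal by blast
  then show ?thesis using assms by (metis map_lookup_mon sorted_wrt_less_distinct)
qed

text \<open>As the entries of \<open>is\<close> increase strictly and those of \<open>\<alpha>\<close> are positive, distinct index
  sequences give distinct monomials, so every coefficient of the defining sum is \<open>0\<close> or \<open>1\<close>.
  The value for lists that are not compositions is irrelevant (it is \<open>0\<close>).\<close>

lift_definition M :: "nat list \<Rightarrow> qsym" is
  "\<lambda>\<alpha>. Power_Series (\<lambda>m.
     if \<alpha> \<in> compositions \<and>
        (\<exists>is. sorted_wrt (<) is \<and> length is = length \<alpha> \<and> m = mon is \<alpha>)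
     then 1 else 0)"
proof (intro CollectI conjI, goal_cases)
  case (1 \<alpha>)
  then show ?case
    by (auto simp: bounded_degree_def Power_Series_inverse mdeg_mon split: if_splits)
next
  case (2 \<alpha>)
  have "(\<exists>ks. sorted_wrt (<) ks \<and> length ks = length \<alpha> \<and> mon js \<beta> = mon ks \<alpha>) \<longleftrightarrow> \<beta> = \<alpha>"
    if "\<alpha> \<in> compositions" "\<beta> \<in> compositions" "sorted_wrt (<) js" "length js = length \<beta>"
    for \<beta> js
    using that mon_inj[of \<beta> \<alpha> js] by blast
  then show ?case
    unfolding quasisymmetric_def by (simp add: Power_Series_inverse cong: conj_cong)
qed

definition F :: "nat list \<Rightarrow> qsym" where
  "F \<alpha> = (\<Sum>\<beta> | \<beta> \<in> compositions \<and> \<beta> \<preceq> \<alpha>. M \<beta>)"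

text \<open>The sum defining \<^const>\<open>F\<close> is finite, so it is not subject to the convention that
  sums over infinite sets are \<open>0\<close>.\<close>

lemma finite_refinements: "finite {\<beta>. \<beta> \<in> compositions \<and> \<beta> \<preceq> \<alpha>}"
proof (rule finite_subset)
  show "finite {\<beta>. set \<beta> \<subseteq> {..sum_list \<alpha>} \<and> length \<beta> \<le> sum_list \<alpha>}"
    by (rule finite_lists_length_le) simp
  have len: "length \<beta> \<le> sum_list \<beta>" if "\<beta> \<in> compositions" for \<beta>
    using that by (induction \<beta>) (auto simp: compositions_def)
  have sum: "sum_list (concat bs) = sum_list (map sum_list bs)" for bs :: "nat list list"
    by (induction bs) auto
  show "{\<beta>. \<beta> \<in> compositions \<and> \<beta> \<preceq> \<alpha>} \<subseteq> {\<beta>. set \<beta> \<subseteq> {..sum_list \<alpha>} \<and> length \<beta> \<le> sum_list \<alpha>}"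
  proof
    fix \<beta> assume "\<beta> \<in> {\<beta>. \<beta> \<in> compositions \<and> \<beta> \<preceq> \<alpha>}"
    then have \<beta>: "\<beta> \<in> compositions" "sum_list \<beta> = sum_list \<alpha>" by (auto simp: refines_def sum)
    then show "\<beta> \<in> {\<beta>. set \<beta> \<subseteq> {..sum_list \<alpha>} \<and> length \<beta> \<le> sum_list \<alpha>}"
      using len[OF \<beta>(1)] member_le_sum_list[of _ \<beta>] by auto
  qed
qed

lemma M_Nil: "M [] = 1"
  by transfer
     (rule power_series_eqI, auto simp: Power_Series_inverse one_power_series.rep_eq compositions_def)

lemma F_Nil: "F [] = 1"
proof -
  have "{\<beta>. \<beta> \<in> compositions \<and> \<beta> \<preceq> []} = {[]}"
    by (auto simp: refines_def compositions_def)
  then show ?thesis by (simp add: F_def M_Nil)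
qed


section \<open>Graded algebra automorphisms\<close>

definition QSym_deg :: "nat \<Rightarrow> qsym set" where
  "QSym_deg n = qsym_span {F \<alpha> | \<alpha>. \<alpha> \<in> compositions \<and> sum_list \<alpha> = n}"

text \<open>The type \<^typ>\<open>qsym\<close> is the whole algebra, so automorphisms are total functions on it and
  bijectivity needs no carrier set.\<close>

definition qsym_linear :: "(qsym \<Rightarrow> qsym) \<Rightarrow> bool" where
  "qsym_linear \<phi> \<longleftrightarrow> Vector_Spaces.linear qsym_scale qsym_scale \<phi>"

definition graded :: "(qsym \<Rightarrow> qsym) \<Rightarrow> bool" where
  "graded \<phi> \<longleftrightarrow> (\<forall>n. \<phi> ` QSym_deg n \<subseteq> QSym_deg n)"

definition algebra_automorphism :: "(qsym \<Rightarrow> qsym) \<Rightarrow> bool" where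
  "algebra_automorphism \<phi> \<longleftrightarrow>
     qsym_linear \<phi> \<and> bij \<phi> \<and> \<phi> 1 = 1 \<and> (\<forall>f g. \<phi> (f * g) = \<phi> f * \<phi> g)"

end

theory Submission
  imports Defs
begin

text \<open>
  Index the fundamental basis by descent compositions of words with distinct letters. Splitting off
  the smallest variable shows that \<open>F \<alpha>\<close> is governed by one rule: the coefficient of \<open>M\<close> at
  \<open>(b, \<beta>)\<close> in the function of a word \<open>w\<close> is \<open>0\<close> unless the first \<open>b\<close> letters of
  \<open>w\<close> increase, and then it is the coefficient at \<open>\<beta>\<close> in the function of the remaining word
  (\<open>qcoeff_F_descent_comp_Cons\<close>). Since that operation is compatible with products, induction
  on \<open>\<beta>\<close> yields the shuffle rule: the product of the functions of two words with disjoint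
  letters is the sum over their shuffles (\<open>fundamental_shuffle_product\<close>).

  The three maps are automorphisms because they come from symmetries of words that respect
  shuffles. Negating the letters complements the descent composition, reading the word backwards
  transposes it, and doing both reverses it (locale \<open>word_symmetry\<close>).

  For the converse encode a composition of \<open>n + 1\<close> by the string of \<open>n\<close> bits that marks its
  descents. By the shuffle rule, the basis elements in \<open>F [1] * F \<alpha>\<close> are exactly those whose
  bit string becomes the bit string of \<open>\<alpha>\<close> after deleting one bit. A graded automorphism that
  permutes the fundamental basis fixes \<open>F [1]\<close>, the only basis element of degree one, so it
  induces an automorphism of the poset of binary strings under deletion
  (\<open>fundamental_automorphism_on_bits\<close>). A binary string of length at least three is
  determined by the set of strings obtained by deleting one bit (\<open>deletions_inject\<close>), hence such
  a poset automorphism is determined by its values on strings of length at most two. There only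
  four possibilities occur: the identity, bitwise negation, reversal and their composite
  (\<open>deletion_automorphism_cases\<close>). They correspond to the identity and the three given maps.
\<close>

section \<open>Coefficients of quasisymmetric functions\<close>

text \<open>The exponents may be zero: peeling off the first entry of an exponent list has to make sense for
  both factors of a product, and one of the factors may not involve the first variable.\<close>

definition qcoeff :: "qsym \<Rightarrow> nat list \<Rightarrow> rat" where
  "qcoeff f u = coeff (series_of f) (mon [0..<length u] u)"

lemma qcoeff_eq:
  assumes "sorted_wrt (<) is" "length is = length u"
  shows "coeff (series_of f) (mon is u) = qcoeff f u"
  unfolding qcoeff_def using assms series_of[of f]
  by (intro quasisymmetric_weak) auto

text \<open>Quasisymmetry lets the variables with exponent zero be squeezed out.\<close>

lemma qcoeff_filter: "qcoeff f u = qcoeff f (filter (\<lambda>e. e \<noteq> 0) u)"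
  unfolding qcoeff_def[of f u]
  by (subst mon_filter, simp, rule qcoeff_eq)
     (simp_all only: sorted_filter_zip length_filter_zip length_map length_upt diff_zero
        sorted_wrt_upt length_filter_zip)

lemma qcoeff_Cons_0: "qcoeff f (0 # u) = qcoeff f u"
  by (subst qcoeff_filter, subst (2) qcoeff_filter) simp

text \<open>Every monomial is the product of powers of its variables in increasing order, with positive
  exponents.\<close>

lemma qsym_eqI:
  assumes "\<And>\<beta>. \<beta> \<in> compositions \<Longrightarrow> qcoeff f \<beta> = qcoeff g \<beta>"
  shows "f = g"
proof -
  have "coeff (series_of f) m = coeff (series_of g) m" for m
  proof -
    define js where "js = sorted_list_of_set (Poly_Mapping.keys m)"
    define u where "u = map (Poly_Mapping.lookup m) js"
    have js: "sorted_wrt (<) js" "set js = Poly_Mapping.keys m" by (simp_all add: js_def)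
    have m: "m = mon js u"
      unfolding u_def using js sorted_wrt_less_distinct by (intro mon_map_lookup[symmetric]) auto
    have "u \<in> compositions" using js by (auto simp: u_def compositions_def in_keys_iff)
    then have "qcoeff f u = qcoeff g u" by (rule assms)
    then have "coeff (series_of f) (mon js u) = coeff (series_of g) (mon js u)"
      using js by (subst (1 2) qcoeff_eq) (simp_all add: u_def)
    then show ?thesis by (simp only: m[symmetric])
  qed
  then show ?thesis by (simp add: power_series_eqI series_of_inject[symmetric])
qed

lemma qcoeff_0: "qcoeff 0 u = 0"
  by (simp add: qcoeff_def zero_qsym.rep_eq zero_power_series.rep_eq)

lemma qcoeff_add: "qcoeff (f + g) u = qcoeff f u + qcoeff g u"
  by (simp add: qcoeff_def plus_qsym.rep_eq plus_power_series.rep_eq)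

lemma qcoeff_scale: "qcoeff (qsym_scale c f) u = c * qcoeff f u"
  by (simp add: qcoeff_def qsym_scale.rep_eq series_scale.rep_eq)

lemma qcoeff_sum: "qcoeff (\<Sum>x\<in>A. f x) u = (\<Sum>x\<in>A. qcoeff (f x) u)"
  by (induction A rule: infinite_finite_induct) (simp_all add: qcoeff_0 qcoeff_add)

lemma qcoeff_M:
  assumes "\<beta> \<in> compositions" "\<alpha> \<in> compositions"
  shows "qcoeff (M \<alpha>) \<beta> = (if \<alpha> = \<beta> then 1 else 0)"
proof -
  have "(\<exists>is. sorted_wrt (<) is \<and> length is = length \<alpha> \<and> mon [0..<length \<beta>] \<beta> = mon is \<alpha>) \<longleftrightarrow> \<alpha> = \<beta>"
    using mon_inj[OF assms(2,1), of _ "[0..<length \<beta>]"] by (auto intro: exI[of _ "[0..<length \<beta>]"])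
  then show ?thesis using assms by (simp add: qcoeff_def M.rep_eq Power_Series_inverse)
qed

text \<open>The coefficient functions turn identities between fundamental functions into statements about
  refinement.\<close>

lemma qcoeff_F:
  assumes "\<beta> \<in> compositions"
  shows "qcoeff (F \<alpha>) \<beta> = (if \<beta> \<preceq> \<alpha> then 1 else 0)"
proof -
  have "qcoeff (F \<alpha>) \<beta> = (\<Sum>\<gamma> | \<gamma> \<in> compositions \<and> \<gamma> \<preceq> \<alpha>. if \<gamma> = \<beta> then 1 else 0)"
    unfolding F_def qcoeff_sum using assms by (intro sum.cong) (auto simp: qcoeff_M)
  then show ?thesis using assms finite_refinements[of \<alpha>] by simp
qed

text \<open>The product rule for coefficient functions. It is stated for arbitrary functions on exponent lists
  so that the first exponent can be fixed in both factors during an induction.\<close>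

definition convolution :: "(nat list \<Rightarrow> rat) \<Rightarrow> (nat list \<Rightarrow> rat) \<Rightarrow> nat list \<Rightarrow> rat" where
  "convolution x y w =
     (\<Sum>(u, v) | length u = length w \<and> length v = length w \<and> map2 (+) u v = w. x u * y v)"

lemma qcoeff_mult: "qcoeff (f * g) w = convolution (qcoeff f) (qcoeff g) w"
proof -
  define js where "js = [0..<length w]"
  let ?exps = "\<lambda>m. map (Poly_Mapping.lookup m) js"
  have js: "distinct js" "length js = length w" by (simp_all add: js_def)
  have keys: "Poly_Mapping.keys a \<subseteq> set js" "Poly_Mapping.keys b \<subseteq> set js"
    if "a + b = mon js w" for a b
  proof -
    have "Poly_Mapping.lookup (mon js w) i = Poly_Mapping.lookup a i + Poly_Mapping.lookup b i" for i
      using that by (metis lookup_add)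
    then show "Poly_Mapping.keys a \<subseteq> set js" "Poly_Mapping.keys b \<subseteq> set js"
      using keys_mon[of js w] by (auto simp: in_keys_iff subset_iff)
  qed
  have exps: "map2 (+) (?exps a) (?exps b) = ?exps (a + b)" for a b
    by (simp add: lookup_add map2_map_map)
  have "qcoeff (f * g) w =
      (\<Sum>(a, b) | a + b = mon js w. coeff (series_of f) a * coeff (series_of g) b)"
    by (simp add: qcoeff_def times_qsym.rep_eq times_power_series.rep_eq js_def)
  also have "\<dots> = convolution (qcoeff f) (qcoeff g) w"
    unfolding convolution_def
  proof (rule sum.reindex_bij_witness[where
        i = "\<lambda>(u, v). (mon js u, mon js v)" and j = "\<lambda>(a, b). (?exps a, ?exps b)"], goal_cases)
    case (1 x)
    then show ?case using js keys by (auto simp: mon_map_lookup)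
  next
    case (2 x)
    then show ?case using js by (auto simp: exps map_lookup_mon)
  next
    case (3 y)
    then obtain u v where "y = (u, v)" "length js = length u" "length js = length v"
      using js by (cases y) simp
    then show ?case using js by (simp add: map_lookup_mon)
  next
    case (4 y)
    then obtain u v where "y = (u, v)" "length js = length u" "length u = length v"
      "map2 (+) u v = w"
      using js by (cases y) simp
    then show ?case using mon_add[of js u v] by simp
  next
    case (5 x)
    obtain a b where x: "x = (a, b)" by (cases x)
    have "mon js (?exps a) = a" "mon js (?exps b) = b"
      using 5 js keys[of a b] by (auto simp: x mon_map_lookup)
    then have "qcoeff f (?exps a) = coeff (series_of f) a" "qcoeff g (?exps b) = coeff (series_of g) b"
      by (simp_all add: qcoeff_def js_def)
    then show ?case by (simp add: x)
  qed
  finally show ?thesis .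
qed

lemma convolution_Nil: "convolution x y [] = x [] * y []"
proof -
  have "{(u :: nat list, v :: nat list). length u = length [] \<and> length v = length [] \<and> map2 (+) u v = []} = {([], [])}"
    by auto
  then show ?thesis by (simp add: convolution_def)
qed

text \<open>Splitting off the first exponent: it is shared between the two factors in all possible ways.\<close>

lemma convolution_Cons:
  "convolution x y (b # w) = (\<Sum>i\<le>b. convolution (\<lambda>u. x (i # u)) (\<lambda>v. y ((b - i) # v)) w)"
proof -
  let ?S = "\<lambda>w :: nat list. {(u, v). length u = length w \<and> length v = length w \<and> map2 (+) u v = w}"
  have "convolution x y (b # w) =
      (\<Sum>(i, u, v)\<in>{..b} \<times> ?S w. x (i # u) * y ((b - i) # v))"
    unfolding convolution_def
  proof (rule sum.reindex_bij_witness[where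
        i = "\<lambda>(i, u, v). (i # u, (b - i) # v)" and j = "\<lambda>(u, v). (hd u, tl u, tl v)"])
    fix p assume "p \<in> ?S (b # w)"
    then obtain i u k v where p: "p = (i # u, k # v)" "b = i + k"
      "length u = length w" "length v = length w" "map2 (+) u v = w"
      by (cases p; cases "fst p"; cases "snd p") auto
    show "(\<lambda>(i, u, v). (i # u, (b - i) # v)) ((\<lambda>(u, v). (hd u, tl u, tl v)) p) = p"
      "(\<lambda>(u, v). (hd u, tl u, tl v)) p \<in> {..b} \<times> ?S w"
      "(case (\<lambda>(u, v). (hd u, tl u, tl v)) p of (i, u, v) \<Rightarrow> x (i # u) * y ((b - i) # v)) =
       (case p of (u, v) \<Rightarrow> x u * y v)"
      by (simp_all add: p(1,2)) (simp_all add: p(3-5))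
  next
    fix q assume "q \<in> {..b} \<times> ?S w"
    then obtain i u v where q: "q = (i, u, v)" "i \<le> b"
      "length u = length w" "length v = length w" "map2 (+) u v = w"
      by (cases q) simp
    show "(\<lambda>(u, v). (hd u, tl u, tl v)) ((\<lambda>(i, u, v). (i # u, (b - i) # v)) q) = q"
      "(\<lambda>(i, u, v). (i # u, (b - i) # v)) q \<in> ?S (b # w)"
      using q(2) by (simp_all add: q(1)) (simp_all add: q(3-5))
  qed
  also have "\<dots> = (\<Sum>i\<le>b. \<Sum>(u, v)\<in>?S w. x (i # u) * y ((b - i) # v))"
    by (rule sum.cartesian_product[symmetric])
  finally show ?thesis by (simp add: convolution_def)
qed

lemma convolution_0: "convolution (\<lambda>_. 0) y w = 0" "convolution x (\<lambda>_. 0) w = 0"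
  by (simp_all add: convolution_def)

section \<open>The fundamental basis\<close>

lemma sum_list_concat: "sum_list (concat bs) = sum_list (map sum_list bs)"
  for bs :: "nat list list"
  by (induction bs) auto

lemma refines_sum_list: "\<beta> \<preceq> \<alpha> \<Longrightarrow> sum_list \<beta> = sum_list \<alpha>"
  by (auto simp: refines_def sum_list_concat)

lemma refines_refl: "\<alpha> \<preceq> \<alpha>"
  unfolding refines_def
  by (rule exI[of _ "map (\<lambda>a. [a]) \<alpha>"]) (auto simp: o_def concat_map_singleton[of "\<lambda>a. a", simplified])

text \<open>Summing consecutive parts strictly shortens a composition unless nothing is summed. This makes the
  transition matrix between the bases \<^const>\<open>F\<close> and \<^const>\<open>M\<close> unitriangular.\<close>

lemma refines_length:
  assumes "\<beta> \<preceq> \<alpha>" shows "length \<alpha> \<le> length \<beta>" "length \<alpha> = length \<beta> \<Longrightarrow> \<alpha> = \<beta>"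
proof -
  have "length bs \<le> length (concat bs) \<and>
      (length bs = length (concat bs) \<longrightarrow> map sum_list bs = concat bs)"
    if "[] \<notin> set bs" for bs :: "nat list list"
    using that
  proof (induction bs)
    case (Cons b bs)
    obtain x b' where "b = x # b'" using Cons.prems by (cases b) auto
    then show ?case using Cons by auto
  qed simp
  then show "length \<alpha> \<le> length \<beta>" "length \<alpha> = length \<beta> \<Longrightarrow> \<alpha> = \<beta>"
    using assms by (auto simp: refines_def)
qed

lemma inj_on_F: "inj_on F compositions"
proof (rule inj_onI)
  fix \<alpha> \<beta> assume *: "\<alpha> \<in> compositions" "\<beta> \<in> compositions" "F \<alpha> = F \<beta>"
  then have "\<alpha> \<preceq> \<beta>" "\<beta> \<preceq> \<alpha>"
    using qcoeff_F[of \<alpha> \<alpha>] qcoeff_F[of \<alpha> \<beta>] qcoeff_F[of \<beta> \<beta>] qcoeff_F[of \<beta> \<alpha>]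
    by (auto simp: refines_refl split: if_splits)
  then show "\<alpha> = \<beta>" using refines_length by (metis le_antisym)
qed

text \<open>A shortest composition \<open>\<alpha>\<close> with a nonzero scalar in a vanishing combination refines no other
  composition in it, so the coefficient at \<open>\<alpha>\<close> shows that its scalar is zero after all.\<close>

lemma independent_F: "qsym.independent (F ` compositions)"
proof -
  have "\<forall>\<alpha>\<in>A. c \<alpha> = 0" if A: "finite A" "A \<subseteq> compositions"
    and sum: "(\<Sum>\<alpha>\<in>A. qsym_scale (c \<alpha>) (F \<alpha>)) = 0" for A c
  proof (rule ccontr)
    assume "\<not> (\<forall>\<alpha>\<in>A. c \<alpha> = 0)"
    then obtain \<alpha> where \<alpha>: "\<alpha> \<in> A" "c \<alpha> \<noteq> 0"
      and min: "\<And>\<beta>. \<beta> \<in> A \<Longrightarrow> c \<beta> \<noteq> 0 \<Longrightarrow> length \<alpha> \<le> length \<beta>"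
      using exists_least_iff[of "\<lambda>n. \<exists>\<alpha>\<in>A. c \<alpha> \<noteq> 0 \<and> n = length \<alpha>"] by (metis not_le)
    have "0 = (\<Sum>\<beta>\<in>A. c \<beta> * (if \<alpha> \<preceq> \<beta> then 1 else 0))"
      using arg_cong[OF sum, of "\<lambda>f. qcoeff f \<alpha>"] \<alpha> A
      by (simp add: qcoeff_sum qcoeff_scale qcoeff_F qcoeff_0 subset_iff)
    also have "\<dots> = (\<Sum>\<beta>\<in>A. if \<beta> = \<alpha> then c \<alpha> else 0)"
    proof (rule sum.cong[OF refl])
      fix \<beta> assume "\<beta> \<in> A"
      have "\<beta> = \<alpha>" if "c \<beta> \<noteq> 0" "\<alpha> \<preceq> \<beta>"
        using min[OF \<open>\<beta> \<in> A\<close> that(1)] refines_length[OF that(2)] by simp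
      then show "c \<beta> * (if \<alpha> \<preceq> \<beta> then 1 else 0) = (if \<beta> = \<alpha> then c \<alpha> else 0)"
        using refines_refl[of \<alpha>] by (cases "c \<beta> = 0") auto
    qed
    also have "\<dots> = c \<alpha>" using \<alpha> A by simp
    finally show False using \<alpha> by simp
  qed
  note zero = this
  show ?thesis
    unfolding qsym.independent_explicit_finite_subsets
  proof (intro allI impI)
    fix S u assume S: "S \<subseteq> F ` compositions" "finite S" "(\<Sum>v\<in>S. qsym_scale (u v) v) = 0"
    obtain A where A: "A \<subseteq> compositions" "S = F ` A" using S(1) by (meson subset_image_iff)
    have inj: "inj_on F A" using inj_on_F A(1) by (rule inj_on_subset)
    have "finite A" using S(2) A(2) inj finite_imageD by blast
    moreover have "(\<Sum>\<alpha>\<in>A. qsym_scale (u (F \<alpha>)) (F \<alpha>)) = 0"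
      using S(3) by (simp add: A(2) sum.reindex[OF inj])
    ultimately have "\<forall>\<alpha>\<in>A. u (F \<alpha>) = 0" using A(1) by (intro zero) auto
    then show "\<forall>v\<in>S. u v = 0" using A(2) by blast
  qed
qed

lemma length_le_sum_list: "\<alpha> \<in> compositions \<Longrightarrow> length \<alpha> \<le> sum_list \<alpha>"
  by (induction \<alpha>) (auto simp: compositions_def)

text \<open>Triangularity again: \<open>F \<alpha> - M \<alpha>\<close> is a sum of \<open>M \<beta>\<close> with \<open>\<beta>\<close> longer than
  \<open>\<alpha>\<close>, and the length is bounded by the sum of the parts.\<close>

lemma M_in_span_F: "\<alpha> \<in> compositions \<Longrightarrow> M \<alpha> \<in> qsym_span (F ` compositions)"
proof (induction "sum_list \<alpha> - length \<alpha>" arbitrary: \<alpha> rule: less_induct)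
  case less
  define R where "R = {\<beta>. \<beta> \<in> compositions \<and> \<beta> \<preceq> \<alpha>}"
  have R: "finite R" "\<alpha> \<in> R" using finite_refinements less.prems refines_refl by (auto simp: R_def)
  have "M \<beta> \<in> qsym_span (F ` compositions)" if "\<beta> \<in> R - {\<alpha>}" for \<beta>
  proof (rule less.hyps)
    have "\<beta> \<preceq> \<alpha>" "\<alpha> \<noteq> \<beta>" using that by (auto simp: R_def)
    then have "length \<alpha> < length \<beta>" "sum_list \<beta> = sum_list \<alpha>"
      using refines_length[of \<beta> \<alpha>] refines_sum_list[of \<beta> \<alpha>] by (auto simp: le_less)
    moreover show "\<beta> \<in> compositions" using that by (simp add: R_def)
    ultimately show "sum_list \<beta> - length \<beta> < sum_list \<alpha> - length \<alpha>"
      using length_le_sum_list[of \<beta>] by simp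
  qed
  then have "(\<Sum>\<beta>\<in>R - {\<alpha>}. M \<beta>) \<in> qsym_span (F ` compositions)"
    by (rule qsym.span_sum)
  moreover have "M \<alpha> = F \<alpha> - (\<Sum>\<beta>\<in>R - {\<alpha>}. M \<beta>)"
    using sum.remove[OF R, of M] by (simp add: F_def R_def)
  ultimately show ?case using less.prems by (auto intro: qsym.span_diff qsym.span_base)
qed

lemma finite_bounded_compositions: "finite {\<alpha> \<in> compositions. sum_list \<alpha> \<le> d}"
proof (rule finite_subset)
  show "{\<alpha> \<in> compositions. sum_list \<alpha> \<le> d} \<subseteq> {\<alpha>. set \<alpha> \<subseteq> {..d} \<and> length \<alpha> \<le> d}"
  proof
    fix \<alpha> assume \<alpha>: "\<alpha> \<in> {\<alpha> \<in> compositions. sum_list \<alpha> \<le> d}"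
    then show "\<alpha> \<in> {\<alpha>. set \<alpha> \<subseteq> {..d} \<and> length \<alpha> \<le> d}"
      using length_le_sum_list[of \<alpha>] by (auto dest: member_le_sum_list)
  qed
  show "finite {\<alpha>. set \<alpha> \<subseteq> {..d} \<and> length \<alpha> \<le> d}"
    by (rule finite_lists_length_le) simp
qed

text \<open>An element of bounded degree is the finite combination of the \<^const>\<open>M\<close> with its own
  coefficients as scalars.\<close>

lemma span_F: "qsym_span (F ` compositions) = UNIV"
proof (rule UNIV_eq_I[symmetric])
  fix f :: qsym
  obtain d where d: "\<And>m. coeff (series_of f) m \<noteq> 0 \<Longrightarrow> mdeg m \<le> d"
    using series_of[of f] by (auto simp: bounded_degree_def)
  define A where "A = {\<alpha> \<in> compositions. sum_list \<alpha> \<le> d}"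
  have A: "finite A" unfolding A_def by (rule finite_bounded_compositions)
  have "f = (\<Sum>\<alpha>\<in>A. qsym_scale (qcoeff f \<alpha>) (M \<alpha>))"
  proof (rule qsym_eqI)
    fix \<beta> assume \<beta>: "\<beta> \<in> compositions"
    have "qcoeff f \<beta> = 0" if "\<beta> \<notin> A"
      using that d[of "mon [0..<length \<beta>] \<beta>"] \<beta> by (auto simp: A_def qcoeff_def mdeg_mon)
    moreover have "qcoeff (\<Sum>\<alpha>\<in>A. qsym_scale (qcoeff f \<alpha>) (M \<alpha>)) \<beta> =
        (\<Sum>\<alpha>\<in>A. if \<alpha> = \<beta> then qcoeff f \<alpha> else 0)"
      unfolding qcoeff_sum qcoeff_scale using \<beta> by (intro sum.cong) (auto simp: qcoeff_M A_def)
    ultimately show "qcoeff f \<beta> = qcoeff (\<Sum>\<alpha>\<in>A. qsym_scale (qcoeff f \<alpha>) (M \<alpha>)) \<beta>"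
      using A by auto
  qed
  also have "\<dots> \<in> qsym_span (F ` compositions)"
    by (intro qsym.span_sum qsym.span_scale M_in_span_F) (simp add: A_def)
  finally show "f \<in> qsym_span (F ` compositions)" .
qed

section \<open>Linear maps on quasisymmetric functions\<close>

interpretation qsym_pair: vector_space_pair qsym_scale qsym_scale ..

lemma qsym_linear_iff:
  "qsym_linear \<phi> \<longleftrightarrow>
    (\<forall>f g. \<phi> (f + g) = \<phi> f + \<phi> g) \<and> (\<forall>c f. \<phi> (qsym_scale c f) = qsym_scale c (\<phi> f))"
  unfolding qsym_linear_def Vector_Spaces.linear_iff using qsym.vector_space_axioms by blast

lemma qsym_linear_0:
  assumes "qsym_linear \<phi>" shows "\<phi> 0 = 0"
  using assms unfolding qsym_linear_iff by (metis add_cancel_right_right)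

lemma qsym_linear_sum:
  assumes "qsym_linear \<phi>" shows "\<phi> (\<Sum>x\<in>A. f x) = (\<Sum>x\<in>A. \<phi> (f x))"
  using assms qsym_linear_0[OF assms]
  by (induction A rule: infinite_finite_induct) (simp_all add: qsym_linear_iff)

lemma qsym_induct [case_names zero step]:
  assumes "P 0" and "\<And>c \<alpha> f. \<alpha> \<in> compositions \<Longrightarrow> P f \<Longrightarrow> P (qsym_scale c (F \<alpha>) + f)"
  shows "P f"
proof -
  have "f \<in> qsym_span (F ` compositions)" by (simp add: span_F)
  then show ?thesis using assms by (induction rule: qsym.span_induct_alt) auto
qed

lemma qsym_linear_eqI:
  assumes "qsym_linear \<phi>" "qsym_linear \<psi>" "\<And>\<alpha>. \<alpha> \<in> compositions \<Longrightarrow> \<phi> (F \<alpha>) = \<psi> (F \<alpha>)"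
  shows "\<phi> = \<psi>"
proof
  fix f show "\<phi> f = \<psi> f"
    by (induction f rule: qsym_induct)
       (use assms assms(1,2)[THEN qsym_linear_0] in \<open>auto simp: qsym_linear_iff\<close>)
qed

text \<open>The fundamental functions form a basis.\<close>

lemma ex1_qsym_linear: "\<exists>!\<phi>. qsym_linear \<phi> \<and> (\<forall>\<alpha>\<in>compositions. \<phi> (F \<alpha>) = g \<alpha>)"
proof -
  obtain \<phi> where "qsym_linear \<phi>"
    "\<forall>f\<in>F ` compositions. \<phi> f = g (the_inv_into compositions F f)"
    using qsym_pair.linear_independent_extend[OF independent_F, of "\<lambda>f. g (the_inv_into compositions F f)"]
    unfolding qsym_linear_def by blast
  then have "qsym_linear \<phi> \<and> (\<forall>\<alpha>\<in>compositions. \<phi> (F \<alpha>) = g \<alpha>)"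
    by (simp add: the_inv_into_f_f[OF inj_on_F])
  then show ?thesis by (intro ex1I) (auto intro: qsym_linear_eqI)
qed

lemma qsym_scale_mult_left: "qsym_scale c f * g = qsym_scale c (f * g)"
  by (rule qsym_eqI)
     (simp add: qcoeff_mult qcoeff_scale convolution_def sum_distrib_left case_prod_unfold mult.assoc)

lemma qsym_scale_mult_right: "f * qsym_scale c g = qsym_scale c (f * g)"
  by (metis mult.commute qsym_scale_mult_left)

text \<open>Both sides are bilinear.\<close>

lemma qsym_linear_mult:
  assumes \<phi>: "qsym_linear \<phi>"
    and basis: "\<And>\<alpha> \<beta>. \<alpha> \<in> compositions \<Longrightarrow> \<beta> \<in> compositions \<Longrightarrow> \<phi> (F \<alpha> * F \<beta>) = \<phi> (F \<alpha>) * \<phi> (F \<beta>)"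
  shows "\<phi> (f * g) = \<phi> f * \<phi> g"
proof -
  have 1: "\<phi> (F \<alpha> * g) = \<phi> (F \<alpha>) * \<phi> g" if "\<alpha> \<in> compositions" for \<alpha> g
    by (induction g rule: qsym_induct)
       (use \<phi> basis that qsym_linear_0[OF \<phi>] in
          \<open>auto simp: qsym_linear_iff distrib_left qsym_scale_mult_right\<close>)
  show ?thesis
    by (induction f rule: qsym_induct)
       (use \<phi> 1 qsym_linear_0[OF \<phi>] in \<open>auto simp: qsym_linear_iff distrib_right qsym_scale_mult_left\<close>)
qed

lemma qcoeff_QSym_deg:
  assumes "f \<in> QSym_deg n" "\<beta> \<in> compositions" "sum_list \<beta> \<noteq> n"
  shows "qcoeff f \<beta> = 0"
  using assms(1) unfolding QSym_deg_def
proof (induction rule: qsym.span_induct_alt)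
  case (step c x y)
  then obtain \<alpha> where "x = F \<alpha>" "sum_list \<alpha> = n" by blast
  then have "qcoeff x \<beta> = 0" using assms(2,3) refines_sum_list[of \<beta> \<alpha>] by (auto simp: qcoeff_F)
  then show ?case using step by (simp add: qcoeff_add qcoeff_scale)
qed (simp add: qcoeff_0)

lemma F_in_QSym_deg_iff:
  assumes "\<alpha> \<in> compositions" shows "F \<alpha> \<in> QSym_deg n \<longleftrightarrow> sum_list \<alpha> = n"
proof
  show "sum_list \<alpha> = n" if "F \<alpha> \<in> QSym_deg n"
    using qcoeff_QSym_deg[OF that assms] qcoeff_F[OF assms, of \<alpha>] refines_refl[of \<alpha>] by auto
  show "F \<alpha> \<in> QSym_deg n" if "sum_list \<alpha> = n"
    unfolding QSym_deg_def using that assms by (intro qsym.span_base) blast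
qed

text \<open>Multiplicities are natural numbers, so nothing cancels and a basis element has a nonzero coordinate
  exactly if it occurs in the sum.\<close>

lemma sums_of_basis_elements_eq:
  assumes "finite A" "finite B" "g ` A \<subseteq> compositions" "h ` B \<subseteq> compositions"
    and "(\<Sum>x\<in>A. F (g x)) = (\<Sum>x\<in>B. F (h x))"
  shows "g ` A = h ` B"
proof -
  let ?coord = "\<lambda>f \<gamma>. qsym.representation (F ` compositions) f (F \<gamma>)"
  have count: "?coord (\<Sum>x\<in>A. F (g x)) \<gamma> = of_nat (card {x \<in> A. g x = \<gamma>})"
    if "finite A" "g ` A \<subseteq> compositions" "\<gamma> \<in> compositions" for A and g :: "'x \<Rightarrow> _" and \<gamma>
  proof -
    have "?coord (\<Sum>x\<in>A. F (g x)) \<gamma> = (\<Sum>x\<in>A. ?coord (F (g x)) \<gamma>)"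
      using that span_F independent_F by (subst qsym.representation_sum) auto
    also have "\<dots> = (\<Sum>x\<in>A. if g x = \<gamma> then 1 else 0)"
      using that inj_on_F independent_F
      by (intro sum.cong) (auto simp: qsym.representation_basis inj_on_eq_iff subset_iff)
    finally show ?thesis using that by (simp add: sum.If_cases Int_def)
  qed
  have "\<gamma> \<in> g ` A \<longleftrightarrow> \<gamma> \<in> h ` B" if "\<gamma> \<in> compositions" for \<gamma>
  proof -
    have "\<gamma> \<in> g ` A \<longleftrightarrow> card {x \<in> A. g x = \<gamma>} \<noteq> 0" using assms(1) by auto
    also have "\<dots> \<longleftrightarrow> card {x \<in> B. h x = \<gamma>} \<noteq> 0"
      using count[OF assms(1,3) that] count[OF assms(2,4) that] assms(5) by simp
    also have "\<dots> \<longleftrightarrow> \<gamma> \<in> h ` B" using assms(2) by auto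
    finally show ?thesis .
  qed
  then show ?thesis using assms(3,4) by blast
qed

section \<open>Compositions as bit strings\<close>

text \<open>The composition of \<open>length s + 1\<close> whose partial sums are the positions of \<^const>\<open>True\<close>
  in \<open>s\<close>, counted from one (lemma \<open>comp_set_comp_of_bits\<close>). Each bit tells whether two
  adjacent boxes of the ribbon of the composition lie in different parts. This covers all
  compositions except the empty one.\<close>

fun comp_of_bits :: "bool list \<Rightarrow> nat list" where
  "comp_of_bits [] = [1]"
| "comp_of_bits (True # s) = 1 # comp_of_bits s"
| "comp_of_bits (False # s) = Suc (hd (comp_of_bits s)) # tl (comp_of_bits s)"

lemma comp_of_bits_nonempty: "comp_of_bits s \<noteq> []"
  by (induction s rule: comp_of_bits.induct) auto

lemma comp_of_bits_composition: "comp_of_bits s \<in> compositions"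
proof (induction s rule: comp_of_bits.induct)
  case (3 s)
  then show ?case using comp_of_bits_nonempty[of s]
    by (cases "comp_of_bits s") (auto simp: compositions_def)
qed (auto simp: compositions_def)

lemma sum_comp_of_bits: "sum_list (comp_of_bits s) = Suc (length s)"
proof (induction s rule: comp_of_bits.induct)
  case (3 s)
  then show ?case using comp_of_bits_nonempty[of s] by (cases "comp_of_bits s") auto
qed auto

lemma comp_set_grow_first: "comp_set (Suc a # \<alpha>) = Suc ` comp_set (a # \<alpha>)"
  by (cases "\<alpha> = []") (auto simp: comp_set_Cons image_image)

lemma comp_set_comp_of_bits:
  "comp_set (comp_of_bits s) = Suc ` {i. i < length s \<and> s ! i}"
proof (induction s rule: comp_of_bits.induct)
  case (2 s)
  have "{i. i < length (True # s) \<and> (True # s) ! i} = insert 0 (Suc ` {i. i < length s \<and> s ! i})"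
    by (auto simp: less_Suc_eq_0_disj)
  then show ?case using 2 comp_of_bits_nonempty by (simp add: comp_set_Cons image_image)
next
  case (3 s)
  have "{i. i < length (False # s) \<and> (False # s) ! i} = Suc ` {i. i < length s \<and> s ! i}"
    by (auto simp: less_Suc_eq_0_disj)
  then show ?case using 3 comp_of_bits_nonempty[of s]
    by (cases "comp_of_bits s") (simp_all add: comp_set_grow_first)
qed auto

text \<open>Mark the partial sums.\<close>

lemma comp_of_bits_surj:
  assumes "\<alpha> \<in> compositions" "\<alpha> \<noteq> []"
  obtains s where "\<alpha> = comp_of_bits s" "Suc (length s) = sum_list \<alpha>"
proof
  let ?n = "sum_list \<alpha>"
  have n: "0 < ?n" using assms length_le_sum_list[of \<alpha>] by (cases \<alpha>) auto
  let ?s = "map (\<lambda>i. Suc i \<in> comp_set \<alpha>) [0..<?n - 1]"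
  have "comp_set (comp_of_bits ?s) = comp_set \<alpha>"
  proof -
    have "comp_set (comp_of_bits ?s) = Suc ` {i. i < ?n - 1 \<and> Suc i \<in> comp_set \<alpha>}"
      unfolding comp_set_comp_of_bits by (intro arg_cong[of _ _ "(`) Suc"]) auto
    also have "\<dots> = comp_set \<alpha>"
    proof -
      have "x \<in> Suc ` {i. i < ?n - 1 \<and> Suc i \<in> comp_set \<alpha>}" if "x \<in> comp_set \<alpha>" for x
        using that comp_set_subset[OF assms(1)] by (cases x) auto
      then show ?thesis by auto
    qed
    finally show ?thesis .
  qed
  then show "\<alpha> = comp_of_bits ?s"
    using assms n comp_of_bits_composition sum_comp_of_bits
    by (intro comp_set_inj) simp_all
  show "Suc (length ?s) = ?n" using n by simp
qed

lemma comp_of_bits_inject: "comp_of_bits s = comp_of_bits t \<longleftrightarrow> s = t"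
proof
  assume eq: "comp_of_bits s = comp_of_bits t"
  have len: "length s = length t"
    using arg_cong[OF eq, of sum_list] by (simp add: sum_comp_of_bits)
  have "Suc ` {i. i < length s \<and> s ! i} = Suc ` {i. i < length t \<and> t ! i}"
    using arg_cong[OF eq, of comp_set] by (simp only: comp_set_comp_of_bits)
  then have "{i. i < length s \<and> s ! i} = {i. i < length t \<and> t ! i}"
    by (simp add: inj_image_eq_iff)
  then show "s = t" using len by (intro nth_equalityI) (auto simp: set_eq_iff)
qed simp

lemma complement_comp_of_bits: "complement (comp_of_bits s) = comp_of_bits (map Not s)"
  unfolding complement_def
proof (rule the1_equality[OF complement_unique], intro conjI)
  have "comp_set (comp_of_bits (map Not s)) = Suc ` {i. i < length s \<and> \<not> s ! i}"
    unfolding comp_set_comp_of_bits by (intro arg_cong[of _ _ "(`) Suc"]) auto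
  also have "\<dots> = {1..<Suc (length s)} - Suc ` {i. i < length s \<and> s ! i}"
  proof -
    have "x \<in> Suc ` {i. i < length s \<and> \<not> s ! i}"
      if "x \<in> {1..<Suc (length s)} - Suc ` {i. i < length s \<and> s ! i}" for x
      using that by (cases x) auto
    then show ?thesis by auto
  qed
  finally show "comp_set (comp_of_bits (map Not s)) =
      {1..<sum_list (comp_of_bits s)} - comp_set (comp_of_bits s)"
    by (simp only: sum_comp_of_bits comp_set_comp_of_bits)
qed (simp_all add: comp_of_bits_composition sum_comp_of_bits)

lemma complement_Nil: "complement [] = []"
  unfolding complement_def
  by (rule the1_equality[OF complement_unique]) (simp add: compositions_def)

lemma comp_set_rev: "comp_set (rev \<alpha>) = (\<lambda>x. sum_list \<alpha> - x) ` comp_set \<alpha>"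
proof -
  have eq: "sum_list (take i (rev \<alpha>)) = sum_list \<alpha> - sum_list (take (length \<alpha> - i) \<alpha>)" for i
  proof -
    have "sum_list \<alpha> = sum_list (take (length \<alpha> - i) \<alpha>) + sum_list (drop (length \<alpha> - i) \<alpha>)"
      by (metis append_take_drop_id sum_list_append)
    then show ?thesis by (simp add: take_rev)
  qed
  show ?thesis
  proof (intro set_eqI iffI)
    fix x assume "x \<in> comp_set (rev \<alpha>)"
    then obtain i where "1 \<le> i" "i < length \<alpha>" "x = sum_list (take i (rev \<alpha>))"
      by (auto simp: comp_set_def)
    then show "x \<in> (\<lambda>x. sum_list \<alpha> - x) ` comp_set \<alpha>"
      unfolding comp_set_def
      by (intro image_eqI[of _ _ "sum_list (take (length \<alpha> - i) \<alpha>)"])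
         (auto simp: eq intro!: exI[of _ "length \<alpha> - i"])
  next
    fix x assume "x \<in> (\<lambda>x. sum_list \<alpha> - x) ` comp_set \<alpha>"
    then obtain i where "1 \<le> i" "i < length \<alpha>" "x = sum_list \<alpha> - sum_list (take i \<alpha>)"
      by (auto simp: comp_set_def)
    then show "x \<in> comp_set (rev \<alpha>)"
      unfolding comp_set_def by (auto simp: eq intro!: exI[of _ "length \<alpha> - i"])
  qed
qed

lemma rev_comp_of_bits: "rev (comp_of_bits s) = comp_of_bits (rev s)"
proof (rule comp_set_inj)
  let ?n = "length s"
  have "comp_set (rev (comp_of_bits s)) = (\<lambda>i. ?n - i) ` {i. i < ?n \<and> s ! i}"
    by (simp add: comp_set_rev sum_comp_of_bits comp_set_comp_of_bits image_image)
  also have "\<dots> = Suc ` {i. i < ?n \<and> rev s ! i}"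
  proof (intro set_eqI iffI)
    fix x assume "x \<in> (\<lambda>i. ?n - i) ` {i. i < ?n \<and> s ! i}"
    then obtain i where "i < ?n" "s ! i" "x = ?n - i" by blast
    then have "x = Suc (?n - Suc i)" "rev s ! (?n - Suc i)" "?n - Suc i < ?n"
      by (auto simp: rev_nth)
    then show "x \<in> Suc ` {i. i < ?n \<and> rev s ! i}" by blast
  next
    fix x assume "x \<in> Suc ` {i. i < ?n \<and> rev s ! i}"
    then obtain i where "i < ?n" "rev s ! i" "x = Suc i" by blast
    then have "x = ?n - (?n - Suc i)" "s ! (?n - Suc i)" "?n - Suc i < ?n"
      by (auto simp: rev_nth)
    then show "x \<in> (\<lambda>i. ?n - i) ` {i. i < ?n \<and> s ! i}" by blast
  qed
  finally show "comp_set (rev (comp_of_bits s)) = comp_set (comp_of_bits (rev s))"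
    by (simp add: comp_set_comp_of_bits)
qed (use comp_of_bits_composition in \<open>auto simp: sum_comp_of_bits compositions_def\<close>)

lemma composition_cases:
  assumes "\<alpha> \<in> compositions"
  obtains "\<alpha> = []" | s where "\<alpha> = comp_of_bits s"
  using comp_of_bits_surj[OF assms] by blast

lemma transpose_comp_of_bits: "transpose_comp (comp_of_bits s) = comp_of_bits (map Not (rev s))"
  by (simp add: transpose_comp_def rev_comp_of_bits complement_comp_of_bits)

lemma transpose_Nil: "transpose_comp [] = []"
  by (simp add: transpose_comp_def complement_Nil)

section \<open>Words and their descent compositions\<close>

fun descents :: "int list \<Rightarrow> bool list" where
  "descents (x # y # w) = (y < x) # descents (y # w)"
| "descents _ = []"

definition descent_comp :: "int list \<Rightarrow> nat list" where
  "descent_comp w = (if w = [] then [] else comp_of_bits (descents w))"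

lemma descent_comp_Nil [simp]: "descent_comp [] = []"
  by (simp add: descent_comp_def)

lemma descent_comp_eq_Nil_iff [simp]: "descent_comp w = [] \<longleftrightarrow> w = []"
  by (simp add: descent_comp_def comp_of_bits_nonempty)

lemma descent_comp_composition: "descent_comp w \<in> compositions"
  by (simp add: descent_comp_def comp_of_bits_composition) (simp add: compositions_def)

lemma length_descents: "length (descents w) = length w - 1"
  by (induction w rule: descents.induct) auto

lemma sum_descent_comp: "sum_list (descent_comp w) = length w"
  by (cases w) (simp_all add: descent_comp_def sum_comp_of_bits length_descents)

lemma descents_append:
  "\<lbrakk>p \<noteq> []; q \<noteq> []\<rbrakk> \<Longrightarrow> descents (p @ q) = descents p @ (hd q < last p) # descents q"
proof (induction p rule: descents.induct)
  case ("2_2" v)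
  then show ?case by (cases q) auto
qed auto

lemma descents_uminus: "distinct w \<Longrightarrow> descents (map uminus w) = map Not (descents w)"
  by (induction w rule: descents.induct) auto

lemma descents_rev: "distinct w \<Longrightarrow> descents (rev w) = rev (map Not (descents w))"
proof (induction w rule: descents.induct)
  case (1 x y w)
  have "descents (rev (x # y # w)) = descents (rev (y # w) @ [x])" by simp
  also have "\<dots> = descents (rev (y # w)) @ [x < y]"
    by (subst descents_append) (simp_all del: rev.simps add: last_rev)
  finally show ?case using 1 by auto
qed auto

lemma descents_strict_mono: "strict_mono f \<Longrightarrow> descents (map f w) = descents w"
  by (induction w rule: descents.induct) (auto simp: strict_mono_less)

text \<open>Prepend a letter larger or smaller than all others.\<close>

lemma ex_word_with_descents: "\<exists>w. w \<noteq> [] \<and> distinct w \<and> descents w = s"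
proof (induction s)
  case Nil
  show ?case by (intro exI[of _ "[0]"]) simp
next
  case (Cons b s)
  then obtain w where w: "w \<noteq> []" "distinct w" "descents w = s" by blast
  define x where "x = (if b then Max (set w) + 1 else Min (set w) - 1)"
  have "y < x" if "y \<in> set w" "b" for y
  proof -
    have "y \<le> Max (set w)" using that by (intro Max_ge) simp_all
    then show ?thesis using that(2) by (simp add: x_def)
  qed
  moreover have "x < y" if "y \<in> set w" "\<not> b" for y
  proof -
    have "Min (set w) \<le> y" using that by (intro Min_le) simp_all
    then show ?thesis using that(2) by (simp add: x_def)
  qed
  ultimately have "distinct (x # w)" "descents (x # w) = b # s"
    using w by (cases w; cases b; force)+
  then show ?case by blast
qed

text \<open>Disjoint letters are obtained by making those of the first word even and those of the second odd,
  which keeps their order.\<close>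

lemma ex_word_pair_with_descents:
  "\<exists>u v. u \<noteq> [] \<and> v \<noteq> [] \<and> distinct (u @ v) \<and> descents u = s \<and> descents v = t"
proof -
  obtain u v where uv: "u \<noteq> []" "distinct u" "descents u = s" "v \<noteq> []" "distinct v" "descents v = t"
    using ex_word_with_descents by metis
  let ?u = "map (\<lambda>x. 2 * x) u" and ?v = "map (\<lambda>x. 2 * x + 1) v"
  have "2 * x \<noteq> 2 * y + 1" for x y :: int by presburger
  then have "distinct (?u @ ?v)" using uv by (auto simp: distinct_map inj_on_def)
  moreover have "descents ?u = s" "descents ?v = t"
    using uv by (simp_all add: descents_strict_mono strict_mono_def)
  ultimately show ?thesis using uv by (intro exI[of _ ?u] exI[of _ ?v]) simp
qed

lemma ex_word_pair:
  assumes "\<alpha> \<in> compositions" "\<beta> \<in> compositions"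
  obtains u v where "distinct (u @ v)" "descent_comp u = \<alpha>" "descent_comp v = \<beta>"
proof -
  have *: "\<exists>w' \<in> {[], w}. descent_comp w' = \<gamma>"
    if "\<gamma> \<in> compositions" "w \<noteq> []" "\<gamma> \<noteq> [] \<Longrightarrow> comp_of_bits (descents w) = \<gamma>" for \<gamma> w
    using that by (cases "\<gamma> = []") (auto simp: descent_comp_def)
  obtain s t where st: "\<alpha> \<noteq> [] \<Longrightarrow> comp_of_bits s = \<alpha>" "\<beta> \<noteq> [] \<Longrightarrow> comp_of_bits t = \<beta>"
    using comp_of_bits_surj assms by metis
  obtain u v where uv: "u \<noteq> []" "v \<noteq> []" "distinct (u @ v)" "descents u = s" "descents v = t"
    using ex_word_pair_with_descents by blast
  obtain u' v' where "u' \<in> {[], u}" "descent_comp u' = \<alpha>" "v' \<in> {[], v}" "descent_comp v' = \<beta>"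
    using *[of \<alpha> u] *[of \<beta> v] assms st uv by blast
  moreover have "distinct (u' @ v')" using calculation uv by auto
  ultimately show thesis using that by blast
qed

section \<open>The shuffle product of fundamental functions\<close>

lemma refines_Nil_iff: "[] \<preceq> \<alpha> \<longleftrightarrow> \<alpha> = []" "\<beta> \<preceq> [] \<longleftrightarrow> \<beta> = []"
proof -
  have "bs = []" if "[] \<notin> set bs" "concat bs = []" for bs :: "nat list list"
    using that by (cases bs) auto
  then show "[] \<preceq> \<alpha> \<longleftrightarrow> \<alpha> = []" "\<beta> \<preceq> [] \<longleftrightarrow> \<beta> = []" by (auto simp: refines_def)
qed

text \<open>The first part of a refinement either is the whole first part or leaves a positive remainder of it,
  which the following parts must refine.\<close>

lemma refines_Cons_Cons:
  assumes "b # \<beta> \<in> compositions"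
  shows "b # \<beta> \<preceq> a # \<alpha> \<longleftrightarrow> b = a \<and> \<beta> \<preceq> \<alpha> \<or> b < a \<and> \<beta> \<preceq> (a - b) # \<alpha>"
proof
  assume "b # \<beta> \<preceq> a # \<alpha>"
  then obtain c cs where bs: "[] \<notin> set (c # cs)" "concat (c # cs) = b # \<beta>"
    "sum_list c = a" "map sum_list cs = \<alpha>"
    unfolding refines_def by (auto simp: map_eq_Cons_conv)
  then obtain c' where c: "c = b # c'" "\<beta> = c' @ concat cs" by (cases c) auto
  show "b = a \<and> \<beta> \<preceq> \<alpha> \<or> b < a \<and> \<beta> \<preceq> (a - b) # \<alpha>"
  proof (cases c')
    case Nil
    then show ?thesis using bs c unfolding refines_def by auto
  next
    case (Cons d c'')
    have "0 < d" using assms c Cons by (auto simp: compositions_def)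
    moreover have "\<beta> \<preceq> (a - b) # \<alpha>"
      unfolding refines_def using bs c Cons by (intro exI[of _ "c' # cs"]) auto
    ultimately show ?thesis using bs c Cons by auto
  qed
next
  assume "b = a \<and> \<beta> \<preceq> \<alpha> \<or> b < a \<and> \<beta> \<preceq> (a - b) # \<alpha>"
  then consider bs where "b = a" "[] \<notin> set bs" "concat bs = \<beta>" "map sum_list bs = \<alpha>"
    | d ds where "b < a" "[] \<notin> set (d # ds)" "concat (d # ds) = \<beta>"
        "sum_list d = a - b" "map sum_list ds = \<alpha>"
    unfolding refines_def by (auto simp: map_eq_Cons_conv)
  then show "b # \<beta> \<preceq> a # \<alpha>"
  proof cases
    case (1 bs)
    then show ?thesis unfolding refines_def by (intro exI[of _ "[b] # bs"]) auto
  next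
    case (2 d ds)
    then show ?thesis unfolding refines_def by (intro exI[of _ "(b # d) # ds"]) auto
  qed
qed

text \<open>A part of the descent composition is a maximal increasing run of letters, and a part of a refinement
  stays inside such a run.\<close>

lemma refines_descent_comp_Cons:
  assumes "distinct w" "b # \<beta> \<in> compositions"
  shows "b # \<beta> \<preceq> descent_comp w \<longleftrightarrow>
    b \<le> length w \<and> sorted_wrt (<) (take b w) \<and> \<beta> \<preceq> descent_comp (drop b w)"
  using assms
proof (induction w arbitrary: b)
  case Nil
  then show ?case by (auto simp: refines_Nil_iff compositions_def)
next
  case (Cons x w)
  have \<beta>: "\<beta> \<in> compositions" and "0 < b" using Cons.prems by (auto simp: compositions_def)
  then obtain b' where b: "b = Suc b'" by (cases b) auto
  show ?case
  proof (cases w)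
    case Nil
    then show ?thesis
      using Cons.prems by (auto simp: b descent_comp_def refines_Cons_Cons refines_Nil_iff)
  next
    case (Cons y w')
    have y: "descent_comp w = comp_of_bits (descents (y # w'))"
      by (simp add: Cons descent_comp_def)
    have srt: "sorted_wrt (<) (x # take b' w) \<longleftrightarrow> (b' = 0 \<or> x < y) \<and> sorted_wrt (<) (take b' w)"
      by (cases b') (auto simp: Cons)
    obtain a \<alpha> where a: "descent_comp w = a # \<alpha>" using Cons by (cases "descent_comp w") auto
    then have "0 < a" using descent_comp_composition[of w] by (simp add: compositions_def)
    show ?thesis
    proof (cases "y < x")
      case True
      then have "descent_comp (x # w) = 1 # descent_comp w"
        by (simp add: descent_comp_def Cons)
      then show ?thesis
        using Cons.prems True srt by (cases b') (auto simp: b refines_Cons_Cons)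
    next
      case False
      then have "x < y" using Cons.prems Cons by simp
      then have dc: "descent_comp (x # w) = Suc a # \<alpha>"
        using a by (simp add: descent_comp_def Cons)
      show ?thesis
      proof (cases b')
        case 0
        then show ?thesis using Cons.prems \<open>0 < a\<close> dc a by (simp add: b refines_Cons_Cons)
      next
        case (Suc b'')
        then have pos: "b' # \<beta> \<in> compositions" using \<beta> by (simp add: compositions_def)
        have "b # \<beta> \<preceq> descent_comp (x # w) \<longleftrightarrow> b' # \<beta> \<preceq> descent_comp w"
          using Cons.prems pos by (simp add: dc a b refines_Cons_Cons)
        also have "\<dots> \<longleftrightarrow> b' \<le> length w \<and> sorted_wrt (<) (take b' w) \<and> \<beta> \<preceq> descent_comp (drop b' w)"
          using Cons.prems pos by (intro Cons.IH) simp_all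
        finally show ?thesis using srt \<open>x < y\<close> by (simp add: b)
      qed
    qed
  qed
qed

lemma qcoeff_F_descent_comp_Nil: "qcoeff (F (descent_comp w)) [] = (if w = [] then 1 else 0)"
  using qcoeff_F[of "[]" "descent_comp w"] by (simp add: compositions_def refines_Nil_iff)

text \<open>Together with the value at \<open>[]\<close>, this recursion determines the fundamental function of a word. It also holds for \<open>b = 0\<close>, where
  it says that a variable with exponent zero can be dropped.\<close>

lemma qcoeff_F_descent_comp_Cons:
  assumes "distinct w"
  shows "qcoeff (F (descent_comp w)) (b # \<beta>) =
    (if b \<le> length w \<and> sorted_wrt (<) (take b w) then qcoeff (F (descent_comp (drop b w))) \<beta> else 0)"
proof (cases "b = 0")
  case False
  let ?\<beta> = "filter (\<lambda>e. e \<noteq> 0) \<beta>"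
  have "b # ?\<beta> \<in> compositions" "?\<beta> \<in> compositions" using False by (auto simp: compositions_def)
  then have "qcoeff (F (descent_comp w)) (b # ?\<beta>) =
    (if b \<le> length w \<and> sorted_wrt (<) (take b w) then qcoeff (F (descent_comp (drop b w))) ?\<beta> else 0)"
    by (simp add: qcoeff_F refines_descent_comp_Cons assms)
  moreover have "qcoeff f (b # \<beta>) = qcoeff f (b # ?\<beta>)" for f
    using qcoeff_filter[of f "b # \<beta>"] False by simp
  ultimately show ?thesis by (simp add: qcoeff_filter[of _ \<beta>])
qed (simp add: qcoeff_Cons_0)

lemma append_in_shuffles_iff:
  "w1 @ w2 \<in> shuffles u v \<longleftrightarrow>
    (\<exists>u1 u2 v1 v2. u = u1 @ u2 \<and> v = v1 @ v2 \<and> w1 \<in> shuffles u1 v1 \<and> w2 \<in> shuffles u2 v2)"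
proof (induction w1 arbitrary: u v)
  case (Cons z w1)
  show ?case (is "_ \<longleftrightarrow> ?R u v")
  proof
    assume "(z # w1) @ w2 \<in> shuffles u v"
    then consider u' where "u = z # u'" "w1 @ w2 \<in> shuffles u' v"
      | v' where "v = z # v'" "w1 @ w2 \<in> shuffles u v'"
      by (auto simp: Cons_in_shuffles_iff neq_Nil_conv)
    then show "?R u v"
    proof cases
      case (1 u')
      then obtain u1 u2 v1 v2 where
        "u' = u1 @ u2" "v = v1 @ v2" "w1 \<in> shuffles u1 v1" "w2 \<in> shuffles u2 v2"
        using Cons.IH by blast
      then have "u = (z # u1) @ u2 \<and> v = v1 @ v2 \<and> z # w1 \<in> shuffles (z # u1) v1 \<and> w2 \<in> shuffles u2 v2"
        using 1 Cons_in_shuffles_leftI by simp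
      then show ?thesis by blast
    next
      case (2 v')
      then obtain u1 u2 v1 v2 where
        "u = u1 @ u2" "v' = v1 @ v2" "w1 \<in> shuffles u1 v1" "w2 \<in> shuffles u2 v2"
        using Cons.IH by blast
      then have "u = u1 @ u2 \<and> v = (z # v1) @ v2 \<and> z # w1 \<in> shuffles u1 (z # v1) \<and> w2 \<in> shuffles u2 v2"
        using 2 Cons_in_shuffles_rightI by simp
      then show ?thesis by blast
    qed
  next
    assume "?R u v"
    then obtain u1 u2 v1 v2 where *:
      "u = u1 @ u2" "v = v1 @ v2" "z # w1 \<in> shuffles u1 v1" "w2 \<in> shuffles u2 v2" by blast
    from *(3) consider u' where "u1 = z # u'" "w1 \<in> shuffles u' v1"
      | v' where "v1 = z # v'" "w1 \<in> shuffles u1 v'"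
      by (auto simp: Cons_in_shuffles_iff neq_Nil_conv)
    then show "(z # w1) @ w2 \<in> shuffles u v"
    proof cases
      case (1 u')
      then have "w1 @ w2 \<in> shuffles (u' @ u2) v" using * Cons.IH by blast
      then show ?thesis using 1 * Cons_in_shuffles_leftI by simp
    next
      case (2 v')
      then have "w1 @ w2 \<in> shuffles u (v' @ v2)" using * Cons.IH by blast
      then show ?thesis using 2 * Cons_in_shuffles_rightI by simp
    qed
  qed
qed auto

text \<open>An increasing list is determined by the set of its entries, so this is the only increasing shuffle of
  the two lists. Hence an increasing prefix of a shuffle is known once the two prefixes it merges are.\<close>

lemma increasing_shuffle:
  fixes p q :: "'a::linorder list"
  assumes "sorted_wrt (<) p" "sorted_wrt (<) q" "set p \<inter> set q = {}"
  shows "sorted_list_of_set (set p \<union> set q) \<in> shuffles p q"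
proof -
  let ?m = "sorted_list_of_set (set p \<union> set q)"
  have m: "sorted_wrt (<) ?m" "set ?m = set p \<union> set q" by simp_all
  have "filter (\<lambda>x. x \<in> set p) ?m = p" "filter (\<lambda>x. x \<notin> set p) ?m = q"
    using assms m by (auto intro!: strict_sorted_equal sorted_wrt_filter)
  then show ?thesis using partition_in_shuffles[of ?m "\<lambda>x. x \<in> set p"] by simp
qed

text \<open>An increasing prefix of length \<open>b\<close> of a shuffle of \<open>u\<close> and \<open>v\<close> merges an increasing
  prefix of \<open>u\<close>, of some length \<open>i\<close>, with one of \<open>v\<close>, of length \<open>b - i\<close>. Conversely \<open>i\<close>
  determines the merged prefix, as there is only one increasing way to merge. The number \<open>i\<close> is
  recovered by counting the letters of \<open>u\<close> in the prefix.\<close>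

lemma sum_increasing_prefix_shuffles:
  fixes G :: "int list \<Rightarrow> rat"
  assumes "distinct (u @ v)"
  defines "inc \<equiv> \<lambda>b w. b \<le> length w \<and> sorted_wrt (<) (take b w)"
  shows "(\<Sum>w | w \<in> shuffles u v \<and> inc b w. G (drop b w)) =
    (\<Sum>i | i \<le> b \<and> inc i u \<and> inc (b - i) v. \<Sum>w\<in>shuffles (drop i u) (drop (b - i) v). G w)"
proof -
  define I where "I = {i. i \<le> b \<and> inc i u \<and> inc (b - i) v}"
  define m where "m i = sorted_list_of_set (set (take i u) \<union> set (take (b - i) v))" for i
  define k where "k w = length (filter (\<lambda>x. x \<in> set u) (take b w))" for w
  have disj: "set u \<inter> set v = {}" using assms by simp
  have fin: "finite I" by (simp add: I_def)
  have m: "m i \<in> shuffles (take i u) (take (b - i) v)" "length (m i) = b"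
    "length (filter (\<lambda>x. x \<in> set u) (m i)) = i" if "i \<in> I" for i
  proof -
    have i: "i \<le> b" "i \<le> length u" "b - i \<le> length v"
      "sorted_wrt (<) (take i u)" "sorted_wrt (<) (take (b - i) v)"
      using that by (auto simp: I_def inc_def)
    have d: "set (take i u) \<inter> set (take (b - i) v) = {}"
      using disj set_take_subset by fast
    show sh: "m i \<in> shuffles (take i u) (take (b - i) v)"
      unfolding m_def by (rule increasing_shuffle) (use i d in auto)
    show "length (m i) = b" using length_shuffles[OF sh] i by simp
    have "filter (\<lambda>x. x \<in> set u) (m i) = filter (\<lambda>x. x \<in> set (take i u)) (m i)"
    proof (rule filter_cong[OF refl])
      fix x assume "x \<in> set (m i)"
      then have "x \<in> set (take i u) \<or> x \<in> set (take (b - i) v)" using set_shuffles[OF sh] by blast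
      then show "x \<in> set u \<longleftrightarrow> x \<in> set (take i u)"
        using disj set_take_subset[of i u] set_take_subset[of "b - i" v] by blast
    qed
    then show "length (filter (\<lambda>x. x \<in> set u) (m i)) = i"
      using filter_shuffles_disjoint1(1)[OF d sh] i by simp
  qed
  have "(\<Sum>i\<in>I. \<Sum>w\<in>shuffles (drop i u) (drop (b - i) v). G w) =
      (\<Sum>(i, w)\<in>(SIGMA i:I. shuffles (drop i u) (drop (b - i) v)). G w)"
    using fin by (intro sum.Sigma) auto
  also have "\<dots> = (\<Sum>w | w \<in> shuffles u v \<and> inc b w. G (drop b w))"
  proof (rule sum.reindex_bij_witness[where i = "\<lambda>w. (k w, drop b w)" and j = "\<lambda>(i, w). m i @ w"])
    fix p assume "p \<in> (SIGMA i:I. shuffles (drop i u) (drop (b - i) v))"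
    then obtain i w where p: "p = (i, w)" "i \<in> I" "w \<in> shuffles (drop i u) (drop (b - i) v)" by blast
    note m = m[OF p(2)]
    have "m i @ w \<in> shuffles u v"
      unfolding append_in_shuffles_iff using m(1) p(3) by (metis append_take_drop_id)
    moreover have "sorted_wrt (<) (m i)" by (simp add: m_def)
    ultimately show "(case p of (i, w) \<Rightarrow> m i @ w) \<in> {w \<in> shuffles u v. inc b w}"
      using m(2) by (simp add: p(1) inc_def)
    show "(k (case p of (i, w) \<Rightarrow> m i @ w), drop b (case p of (i, w) \<Rightarrow> m i @ w)) = p"
      using m(2,3) by (simp add: p(1) k_def)
    show "G (drop b (case p of (i, w) \<Rightarrow> m i @ w)) = (case p of (i, w) \<Rightarrow> G w)"
      using m(2) by (simp add: p(1))
  next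
    fix w assume "w \<in> {w \<in> shuffles u v. inc b w}"
    then have w: "take b w @ drop b w \<in> shuffles u v" "b \<le> length w" "sorted_wrt (<) (take b w)"
      by (simp_all add: inc_def)
    from w(1) obtain u1 u2 v1 v2 where uv: "u = u1 @ u2" "v = v1 @ v2"
      "take b w \<in> shuffles u1 v1" "drop b w \<in> shuffles u2 v2"
      unfolding append_in_shuffles_iff by blast
    have d: "set u1 \<inter> set v1 = {}" using disj uv by auto
    have b: "b = length u1 + length v1" using length_shuffles[OF uv(3)] w(2) by simp
    note f = filter_shuffles_disjoint1[OF d uv(3)]
    have srt: "sorted_wrt (<) u1" "sorted_wrt (<) v1"
      using sorted_wrt_filter[OF w(3)] f by metis+
    have "filter (\<lambda>x. x \<in> set u) (take b w) = filter (\<lambda>x. x \<in> set u1) (take b w)"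
      using set_shuffles[OF uv(3)] disj uv by (intro filter_cong) auto
    then have k: "k w = length u1" using f(1) by (simp add: k_def)
    have I: "k w \<in> I" using srt b by (simp add: k I_def inc_def uv)
    have "m (k w) = take b w"
    proof (rule strict_sorted_equal)
      show "set (m (k w)) = set (take b w)"
        using set_shuffles[OF uv(3)] b by (simp add: m_def k uv)
    qed (use w in \<open>simp_all add: m_def\<close>)
    then show "(case (k w, drop b w) of (i, w) \<Rightarrow> m i @ w) = w" by simp
    show "(k w, drop b w) \<in> (SIGMA i:I. shuffles (drop i u) (drop (b - i) v))"
      using I uv(4) b by (simp add: k uv)
  qed
  finally show ?thesis by (simp add: I_def)
qed

text \<open>Splitting off the first variable turns the left hand side into a sum over pairs of increasing
  prefixes, and the right hand side into a sum over increasing prefixes of shuffles.\<close>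

lemma shuffle_product_qcoeff:
  assumes "distinct (u @ v)"
  shows "convolution (qcoeff (F (descent_comp u))) (qcoeff (F (descent_comp v))) \<beta> =
    (\<Sum>w\<in>shuffles u v. qcoeff (F (descent_comp w)) \<beta>)"
  using assms
proof (induction \<beta> arbitrary: u v)
  case Nil
  have "(\<Sum>w\<in>shuffles u v. qcoeff (F (descent_comp w)) []) = (\<Sum>w\<in>shuffles u v. if [] = w then 1 else 0)"
    by (intro sum.cong) (auto simp: qcoeff_F_descent_comp_Nil)
  then show ?case by (simp add: convolution_Nil qcoeff_F_descent_comp_Nil sum.delta)
next
  case (Cons b \<beta>)
  define inc where "inc = (\<lambda>b (w :: int list). b \<le> length w \<and> sorted_wrt (<) (take b w))"
  define c where "c w = qcoeff (F (descent_comp w))" for w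
  have c_Cons: "c w (b # \<beta>) = (if inc b w then c (drop b w) \<beta> else 0)" if "distinct w" for w b \<beta>
    unfolding c_def inc_def using that by (rule qcoeff_F_descent_comp_Cons)
  have d: "distinct u" "distinct v" using Cons.prems by simp_all
  have IH: "convolution (c (drop i u)) (c (drop j v)) \<beta> =
      (\<Sum>w\<in>shuffles (drop i u) (drop j v). c w \<beta>)" for i j
    unfolding c_def
  proof (rule Cons.IH)
    show "distinct (drop i u @ drop j v)"
      using Cons.prems set_drop_subset[of i u] set_drop_subset[of j v] by auto
  qed
  have "convolution (c u) (c v) (b # \<beta>) =
      (\<Sum>i\<le>b. convolution (\<lambda>w. c u (i # w)) (\<lambda>w. c v ((b - i) # w)) \<beta>)"
    by (rule convolution_Cons)
  also have "\<dots> = (\<Sum>i\<le>b. if inc i u \<and> inc (b - i) v then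
      \<Sum>w\<in>shuffles (drop i u) (drop (b - i) v). c w \<beta> else 0)"
    unfolding c_Cons[OF d(1)] c_Cons[OF d(2)] IH[symmetric]
    by (intro sum.cong) (auto simp: convolution_0)
  also have "\<dots> = (\<Sum>i | i \<le> b \<and> inc i u \<and> inc (b - i) v.
      \<Sum>w\<in>shuffles (drop i u) (drop (b - i) v). c w \<beta>)"
    by (simp add: sum.inter_filter[symmetric])
  also have "\<dots> = (\<Sum>w | w \<in> shuffles u v \<and> inc b w. c (drop b w) \<beta>)"
    unfolding inc_def by (rule sum_increasing_prefix_shuffles[OF Cons.prems, symmetric])
  also have "\<dots> = (\<Sum>w\<in>shuffles u v. if inc b w then c (drop b w) \<beta> else 0)"
    by (simp add: sum.inter_filter)
  also have "\<dots> = (\<Sum>w\<in>shuffles u v. c w (b # \<beta>))"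
  proof (rule sum.cong[OF refl])
    fix w assume w: "w \<in> shuffles u v"
    have "set u \<inter> set v = {}" using Cons.prems by simp
    then have "distinct w" using d w by (rule_tac distinct_disjoint_shuffles)
    then show "(if inc b w then c (drop b w) \<beta> else 0) = c w (b # \<beta>)" by (rule c_Cons[symmetric])
  qed
  finally show ?case by (simp add: c_def)
qed

text \<open>As \<^const>\<open>shuffles\<close> is a set, the letters have to be distinct for every shuffle to be counted
  with its multiplicity, which is then one.\<close>

theorem fundamental_shuffle_product:
  assumes "distinct (u @ v)"
  shows "F (descent_comp u) * F (descent_comp v) = (\<Sum>w\<in>shuffles u v. F (descent_comp w))"
  by (rule qsym_eqI) (simp add: qcoeff_mult qcoeff_sum shuffle_product_qcoeff assms del: distinct_append)

section \<open>Automorphisms from symmetries of words\<close>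

lemma shuffles_map: "shuffles (map f u) (map f v) = map f ` shuffles u v"
  by (induction u v rule: shuffles.induct) (simp_all add: image_Un image_image)

lemma shuffles_rev: "shuffles (rev u) (rev v) = rev ` shuffles u v"
proof -
  have sub: "rev ` shuffles u v \<subseteq> shuffles (rev u) (rev v)" for u v :: "'a list"
  proof (induction u v rule: shuffles.induct)
    case (3 x u y v)
    have "rev w @ [x] \<in> shuffles (rev u @ [x]) (rev (y # v))" if "w \<in> shuffles u (y # v)" for w
    proof -
      have "rev w \<in> shuffles (rev u) (rev (y # v))" using that 3 by blast
      moreover have "[x] \<in> shuffles [x] []" by simp
      ultimately show ?thesis unfolding append_in_shuffles_iff by (metis append_Nil2)
    qed
    moreover have "rev w @ [y] \<in> shuffles (rev (x # u)) (rev v @ [y])" if "w \<in> shuffles (x # u) v" for w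
    proof -
      have "rev w \<in> shuffles (rev (x # u)) (rev v)" using that 3 by blast
      moreover have "[y] \<in> shuffles [] [y]" by simp
      ultimately show ?thesis unfolding append_in_shuffles_iff by (metis append_Nil2)
    qed
    ultimately show ?case by auto
  qed auto
  show ?thesis
    using sub[of u v] image_mono[OF sub[of "rev u" "rev v"], of rev] by (auto simp: image_image)
qed

definition fundamental_automorphism :: "(qsym \<Rightarrow> qsym) \<Rightarrow> bool" where
  "fundamental_automorphism \<phi> \<longleftrightarrow>
     algebra_automorphism \<phi> \<and> graded \<phi> \<and> \<phi> ` (F ` compositions) = F ` compositions"

text \<open>A symmetry \<open>\<theta>\<close> of words that respects shuffles and acts on descent compositions through an
  involution \<open>\<tau>\<close>. The shuffle rule makes \<open>F \<alpha> \<mapsto> F (\<tau> \<alpha>)\<close> multiplicative.\<close>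

locale word_symmetry =
  fixes \<theta> :: "int list \<Rightarrow> int list" and \<tau> :: "nat list \<Rightarrow> nat list"
  assumes inj: "inj \<theta>"
    and length: "length (\<theta> w) = length w"
    and distinct: "distinct (u @ v) \<Longrightarrow> distinct (\<theta> u @ \<theta> v)"
    and shuffles: "shuffles (\<theta> u) (\<theta> v) = \<theta> ` shuffles u v"
    and descent_comp: "distinct w \<Longrightarrow> descent_comp (\<theta> w) = \<tau> (descent_comp w)"
    and involution: "\<alpha> \<in> compositions \<Longrightarrow> \<tau> (\<tau> \<alpha>) = \<alpha>"
begin

lemma composition: "\<alpha> \<in> compositions \<Longrightarrow> \<tau> \<alpha> \<in> compositions"
  and sum_list: "\<alpha> \<in> compositions \<Longrightarrow> sum_list (\<tau> \<alpha>) = sum_list \<alpha>"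
proof -
  assume "\<alpha> \<in> compositions"
  then obtain u v where "distinct (u @ v)" "descent_comp u = \<alpha>" using ex_word_pair by blast
  then have u: "\<tau> \<alpha> = descent_comp (\<theta> u)" "sum_list \<alpha> = length u"
    using descent_comp[of u] sum_descent_comp[of u] by auto
  then show "\<tau> \<alpha> \<in> compositions" "sum_list (\<tau> \<alpha>) = sum_list \<alpha>"
    by (simp_all add: descent_comp_composition sum_descent_comp length)
qed

lemma image_compositions: "\<tau> ` compositions = compositions"
  using composition involution by (metis (no_types, lifting) image_eqI image_subsetI subsetI subset_antisym)

lemma fundamental_automorphism:
  assumes \<phi>: "qsym_linear \<phi>" "\<And>\<alpha>. \<alpha> \<in> compositions \<Longrightarrow> \<phi> (F \<alpha>) = F (\<tau> \<alpha>)"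
  shows "fundamental_automorphism \<phi>"
proof -
  have self_inverse: "\<phi> \<circ> \<phi> = id"
  proof (rule qsym_linear_eqI)
    show "qsym_linear (\<phi> \<circ> \<phi>)" "qsym_linear id" using \<phi>(1) by (simp_all add: qsym_linear_iff)
  qed (simp add: \<phi>(2) involution composition)
  have bij: "bij \<phi>" by (rule o_bij[OF self_inverse self_inverse])
  have Nil: "[] \<in> compositions" by (simp add: compositions_def)
  have "\<tau> [] = []"
    using sum_list[OF Nil] length_le_sum_list[OF composition[OF Nil]]
    by (simp only: sum_list.Nil le_zero_eq length_0_conv)
  then have one: "\<phi> 1 = 1" using \<phi>(2)[OF Nil] by (simp add: F_Nil)
  have mult: "\<phi> (f * g) = \<phi> f * \<phi> g" for f g
  proof (rule qsym_linear_mult[OF \<phi>(1)])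
    fix \<alpha> \<beta> assume "\<alpha> \<in> compositions" "\<beta> \<in> compositions"
    then obtain u v where uv: "distinct (u @ v)" "descent_comp u = \<alpha>" "descent_comp v = \<beta>"
      by (rule ex_word_pair)
    have F\<theta>: "\<phi> (F (descent_comp w)) = F (descent_comp (\<theta> w))" if "distinct w" for w
      using that \<phi>(2) by (simp add: descent_comp descent_comp_composition)
    have "\<phi> (F \<alpha> * F \<beta>) = (\<Sum>w\<in>shuffles u v. \<phi> (F (descent_comp w)))"
      using uv fundamental_shuffle_product[OF uv(1)] \<phi>(1) by (simp add: qsym_linear_sum)
    also have "\<dots> = (\<Sum>w\<in>shuffles u v. F (descent_comp (\<theta> w)))"
    proof (rule sum.cong[OF refl])
      fix w assume "w \<in> shuffles u v"
      moreover have "distinct u" "distinct v" "set u \<inter> set v = {}" using uv(1) by simp_all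
      ultimately have "distinct w" by (rule_tac distinct_disjoint_shuffles)
      then show "\<phi> (F (descent_comp w)) = F (descent_comp (\<theta> w))" by (rule F\<theta>)
    qed
    also have "\<dots> = (\<Sum>w\<in>shuffles (\<theta> u) (\<theta> v). F (descent_comp w))"
      unfolding shuffles using inj by (subst sum.reindex) (auto intro: inj_on_subset)
    also have "\<dots> = F (descent_comp (\<theta> u)) * F (descent_comp (\<theta> v))"
      by (rule fundamental_shuffle_product[OF distinct[OF uv(1)], symmetric])
    also have "\<dots> = \<phi> (F \<alpha>) * \<phi> (F \<beta>)" using uv F\<theta>[of u] F\<theta>[of v] by simp
    finally show "\<phi> (F \<alpha> * F \<beta>) = \<phi> (F \<alpha>) * \<phi> (F \<beta>)" .
  qed
  have "\<phi> f \<in> QSym_deg n" if "f \<in> QSym_deg n" for f n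
    using that unfolding QSym_deg_def
  proof (induction rule: qsym.span_induct_alt)
    case base
    show ?case using qsym_linear_0[OF \<phi>(1)] qsym.span_zero by simp
  next
    case (step c x y)
    then obtain \<alpha> where \<alpha>: "x = F \<alpha>" "\<alpha> \<in> compositions" "sum_list \<alpha> = n" by blast
    have "\<phi> x \<in> qsym_span {F \<alpha> | \<alpha>. \<alpha> \<in> compositions \<and> sum_list \<alpha> = n}"
      using \<alpha> composition sum_list \<phi>(2) by (intro qsym.span_base) auto
    moreover have "\<phi> (qsym_scale c x + y) = qsym_scale c (\<phi> x) + \<phi> y"
      using \<phi>(1) by (simp add: qsym_linear_iff)
    ultimately show ?case using step by (simp add: qsym.span_add qsym.span_scale)
  qed
  then have "graded \<phi>" by (auto simp: graded_def)
  moreover have "\<phi> ` (F ` compositions) = F ` compositions"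
  proof -
    have "\<phi> ` (F ` compositions) = F ` (\<tau> ` compositions)"
      unfolding image_image using \<phi>(2) by (intro image_cong) auto
    then show ?thesis by (simp only: image_compositions)
  qed
  ultimately show ?thesis
    using \<phi>(1) bij one mult by (simp add: fundamental_automorphism_def algebra_automorphism_def)
qed

end

lemma word_symmetry_complement: "word_symmetry (map uminus) complement"
proof
  show "descent_comp (map uminus w) = complement (descent_comp w)" if "distinct w" for w
    using that by (simp add: descent_comp_def complement_comp_of_bits complement_Nil descents_uminus)
  show "complement (complement \<alpha>) = \<alpha>" if "\<alpha> \<in> compositions" for \<alpha>
    using that by (rule composition_cases)
       (simp_all add: complement_comp_of_bits complement_Nil o_def)
qed (auto simp: shuffles_map distinct_map inj_on_def)

lemma word_symmetry_transpose: "word_symmetry rev transpose_comp"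
proof
  show "descent_comp (rev w) = transpose_comp (descent_comp w)" if "distinct w" for w
    using that by (simp add: descent_comp_def transpose_comp_of_bits transpose_Nil descents_rev rev_map)
  show "transpose_comp (transpose_comp \<alpha>) = \<alpha>" if "\<alpha> \<in> compositions" for \<alpha>
    using that by (rule composition_cases)
       (simp_all add: transpose_comp_of_bits transpose_Nil o_def rev_map)
qed (auto simp: shuffles_rev)

lemma word_symmetry_rev: "word_symmetry (rev \<circ> map uminus) rev"
proof
  show "descent_comp ((rev \<circ> map uminus) w) = rev (descent_comp w)" if "distinct w" for w
    using that
    by (simp add: descent_comp_def rev_comp_of_bits descents_rev descents_uminus distinct_map o_def)
  show "shuffles ((rev \<circ> map uminus) u) ((rev \<circ> map uminus) v) = (rev \<circ> map uminus) ` shuffles u v"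
    for u v :: "int list"
    by (simp add: shuffles_rev shuffles_map image_comp)
qed (auto simp: distinct_map inj_on_def)

section \<open>The deletion order on binary strings\<close>

fun deletions :: "'a list \<Rightarrow> 'a list set" where
  "deletions [] = {}"
| "deletions (c # s) = insert s ((#) c ` deletions s)"

lemma deletions_iff: "s \<in> deletions t \<longleftrightarrow> (\<exists>p c q. t = p @ c # q \<and> s = p @ q)"
proof (induction t arbitrary: s)
  case (Cons a t)
  show ?case (is "_ \<longleftrightarrow> ?R")
  proof
    assume "s \<in> deletions (a # t)"
    then consider "s = t" | s' where "s = a # s'" "s' \<in> deletions t" by auto
    then show ?R
    proof cases
      case 1
      then have "a # t = [] @ a # t \<and> s = [] @ t" by simp
      then show ?thesis by blast
    next
      case 2
      then obtain p c q where "t = p @ c # q" "s' = p @ q" unfolding Cons.IH by blast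
      then have "a # t = (a # p) @ c # q \<and> s = (a # p) @ q" using 2 by simp
      then show ?thesis by blast
    qed
  next
    assume ?R
    then obtain p c q where pq: "a # t = p @ c # q" "s = p @ q" by blast
    show "s \<in> deletions (a # t)"
    proof (cases p)
      case (Cons b p')
      then have "p' @ q \<in> deletions t" unfolding Cons.IH using pq by auto
      then show ?thesis using pq Cons by simp
    qed (use pq in simp)
  qed
qed simp

lemma length_deletions: "s \<in> deletions t \<Longrightarrow> Suc (length s) = length t"
  by (auto simp: deletions_iff)

lemma deletions_map: "deletions (map f t) = map f ` deletions t"
  by (induction t) (auto simp: image_image)

lemma deletions_rev: "deletions (rev t) = rev ` deletions t"
proof -
  have sub: "rev ` deletions t \<subseteq> deletions (rev t)" for t :: "'a list"
  proof
    fix s assume "s \<in> rev ` deletions t"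
    then obtain p c q where "t = p @ c # q" "s = rev (p @ q)" by (auto simp: deletions_iff)
    then have "rev t = rev q @ c # rev p" "s = rev q @ rev p" by simp_all
    then show "s \<in> deletions (rev t)" unfolding deletions_iff by blast
  qed
  show ?thesis using sub[of t] image_mono[OF sub[of "rev t"], of rev] by (auto simp: image_image)
qed

lemma Cons_in_deletions_same: "c # s \<in> deletions (c # t) \<longleftrightarrow> s \<in> deletions t"
  by (cases t) auto

text \<open>The bound is sharp, as \<open>[False, True]\<close> and \<open>[True, False]\<close> have the same deletions.
  If the strings start with the same bit, remove it: the deletions starting with that bit are
  precisely those of the remaining strings, preceded by the bit. If the first bits differ, then each
  remaining string equals the first bit of the other string followed by any deletion of the other
  remaining string, and the two deletions at the front already give a contradiction.\<close>

lemma deletions_inject: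
  fixes s t :: "bool list"
  assumes "deletions s = deletions t" "length s = length t" "3 \<le> length s"
  shows "s = t"
  using assms
proof (induction s arbitrary: t)
  case (Cons a x)
  obtain b y where t: "t = b # y" using Cons.prems by (cases t) auto
  have eq: "deletions (a # x) = deletions (b # y)" using Cons.prems t by simp
  have len: "length x = length y" "2 \<le> length x" using Cons.prems t by auto
  show ?case
  proof (cases "a = b")
    case True
    have xy: "deletions x = deletions y"
      using eq Cons_in_deletions_same[of a _ x] Cons_in_deletions_same[of a _ y] True by blast
    show ?thesis
    proof (cases "3 \<le> length x")
      case True
      then show ?thesis using Cons.IH[OF xy len(1)] \<open>a = b\<close> t by simp
    next
      case False
      then have "length x = 2" using len by simp
      moreover have "length y = 2" using calculation len(1) by simp
      ultimately obtain x1 x2 y1 y2 where "x = [x1, x2]" "y = [y1, y2]"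
        by (auto simp: numeral_2_eq_2 length_Suc_conv)
      \<comment> \<open>Strings of length two need not be determined by their deletions, so the common first bit is kept.\<close>
      moreover have "z \<in> deletions (a # x) \<longleftrightarrow> z \<in> deletions (b # y)" for z using eq by simp
      from this[of "[False, False]"] this[of "[False, True]"]
        this[of "[True, False]"] this[of "[True, True]"]
      have "x1 = y1 \<and> x2 = y2" unfolding \<open>x = [x1, x2]\<close> \<open>y = [y1, y2]\<close> \<open>a = b\<close>
        by (cases b; cases x1; cases x2; cases y1; cases y2; simp)
      ultimately show ?thesis using t \<open>a = b\<close> by simp
    qed
  next
    case False
    obtain x1 x2 x' where x: "x = x1 # x2 # x'"
      using len by (metis Suc_le_length_iff numeral_2_eq_2)
    obtain y1 y2 y' where y: "y = y1 # y2 # y'"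
      using len by (metis Suc_le_length_iff numeral_2_eq_2)
    have "\<And>z. z \<in> deletions x \<Longrightarrow> a # z = y" "\<And>z. z \<in> deletions y \<Longrightarrow> b # z = x"
      using eq False by auto
    from this(1)[of "x2 # x'"] this(1)[of "x1 # x'"] this(2)[of "y2 # y'"] this(2)[of "y1 # y'"]
    show ?thesis using False by (simp add: x y)
  qed
qed simp

text \<open>An automorphism of the graded poset of binary strings in which one string lies below another if it
  is a subword. Deleting one bit is the covering relation.\<close>

locale deletion_automorphism =
  fixes \<tau> :: "bool list \<Rightarrow> bool list"
  assumes bij: "bij \<tau>"
    and length: "length (\<tau> s) = length s"
    and deletions: "\<tau> s \<in> deletions (\<tau> t) \<longleftrightarrow> s \<in> deletions t"
begin

lemma deletions_image: "deletions (\<tau> t) = \<tau> ` deletions t"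
proof (intro set_eqI iffI)
  fix s assume s: "s \<in> deletions (\<tau> t)"
  obtain s' where "s = \<tau> s'" using bij_is_surj[OF bij] by (elim surjE)
  then show "s \<in> \<tau> ` deletions t" using s deletions by blast
qed (use deletions in blast)

text \<open>Strings of length at least three are determined by their deletions, which are shorter.\<close>

lemma determined_by_short:
  assumes \<sigma>: "deletion_automorphism \<sigma>"
    and short: "\<And>s. length s \<le> 2 \<Longrightarrow> \<tau> s = \<sigma> s"
  shows "\<tau> s = \<sigma> s"
proof (induction "length s" arbitrary: s rule: less_induct)
  case less
  interpret \<sigma>: deletion_automorphism \<sigma> by (rule \<sigma>)
  show ?case
  proof (cases "length s \<le> 2")
    case False
    have "\<tau> ` deletions s = \<sigma> ` deletions s"
      using length_deletions less.hyps by (intro image_cong) force+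
    then have "deletions (\<tau> s) = deletions (\<sigma> s)"
      by (simp add: deletions_image \<sigma>.deletions_image)
    then show ?thesis
      using False by (intro deletions_inject) (auto simp: length \<sigma>.length)
  qed (rule short)
qed

end

lemma deletion_automorphism_id: "deletion_automorphism id"
  by standard simp_all

lemma deletion_automorphism_rev: "deletion_automorphism rev"
proof
  show bij: "bij (rev :: bool list \<Rightarrow> _)" by (rule o_bij[of rev]) (simp_all add: fun_eq_iff)
  show "rev s \<in> deletions (rev t) \<longleftrightarrow> s \<in> deletions t" for s t :: "bool list"
    unfolding deletions_rev by (rule inj_image_mem_iff[OF bij_is_inj[OF bij]])
qed simp

lemma deletion_automorphism_not: "deletion_automorphism (map Not)"
proof
  show bij: "bij (map Not)" by (rule o_bij[of "map Not"]) (simp_all add: fun_eq_iff o_def)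
  show "map Not s \<in> deletions (map Not t) \<longleftrightarrow> s \<in> deletions t" for s t
    unfolding deletions_map by (rule inj_image_mem_iff[OF bij_is_inj[OF bij]])
qed simp

lemma deletion_automorphism_comp:
  "\<lbrakk>deletion_automorphism \<sigma>; deletion_automorphism \<tau>\<rbrakk> \<Longrightarrow> deletion_automorphism (\<sigma> \<circ> \<tau>)"
  unfolding deletion_automorphism_def by (simp add: bij_comp)

lemma length_le_2_cases:
  fixes P :: "bool list \<Rightarrow> bool"
  assumes "P []" "P [False]" "P [True]"
    "P [False, False]" "P [False, True]" "P [True, False]" "P [True, True]"
    and "length s \<le> 2"
  shows "P s"
proof -
  consider "s = []" | a where "s = [a]" | a b where "s = [a, b]"
    using assms(8) by (cases s; cases "tl s"; cases "tl (tl s)") auto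
  then show ?thesis
  proof cases
    case (2 a) then show ?thesis using assms by (cases a) auto
  next
    case (3 a b) then show ?thesis using assms by (cases a; cases b) auto
  qed (use assms in auto)
qed

text \<open>On strings of length one the automorphism is the identity or the negation. This determines it on
  the constant strings of length two, while the two other strings of length two have the same
  deletions and may be interchanged.\<close>

theorem deletion_automorphism_cases:
  assumes "deletion_automorphism \<tau>"
  shows "\<tau> \<in> {id, map Not, rev, rev \<circ> map Not}"
proof -
  interpret deletion_automorphism \<tau> by (rule assms)
  have inj: "\<tau> s = \<tau> t \<longleftrightarrow> s = t" for s t using bij by (simp add: bij_def inj_eq)
  have short: "\<tau> = \<sigma>" if "deletion_automorphism \<sigma>" "\<tau> [False] = \<sigma> [False]" "\<tau> [True] = \<sigma> [True]"
    "\<tau> [False, False] = \<sigma> [False, False]" "\<tau> [False, True] = \<sigma> [False, True]"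
    "\<tau> [True, False] = \<sigma> [True, False]" "\<tau> [True, True] = \<sigma> [True, True]" for \<sigma>
  proof
    fix s
    show "\<tau> s = \<sigma> s"
    proof (rule determined_by_short[OF that(1)])
      fix s :: "bool list" assume "length s \<le> 2"
      moreover have "\<tau> [] = \<sigma> []"
        using length[of "[]"] deletion_automorphism.length[OF that(1), of "[]"] by simp
      ultimately show "\<tau> s = \<sigma> s" using that(2-) by (rule_tac length_le_2_cases[of _ s]) auto
    qed
  qed
  have 1: "\<tau> [c] = [False] \<or> \<tau> [c] = [True]" for c
    using length[of "[c]"] by (auto simp: length_Suc_conv)
  obtain a where a: "\<tau> [False] = [a]" using 1 by blast
  have na: "\<tau> [True] = [\<not> a]"
    using 1[of True] inj[of "[False]" "[True]"] a by (cases a) auto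
  have 2: "\<exists>x y. \<tau> [c, d] = [x, y] \<and> {[y], [x]} = {\<tau> [d], \<tau> [c]}" for c d
  proof -
    obtain x y where xy: "\<tau> [c, d] = [x, y]"
      using length[of "[c, d]"] by (auto simp: length_Suc_conv)
    then show ?thesis using deletions_image[of "[c, d]"] by simp
  qed
  have const: "\<tau> [c, c] = \<tau> [c] @ \<tau> [c]" for c
    using 2[of c c] by (auto dest: sym)
  have "\<exists>b. \<tau> [c, \<not> c] = [b, \<not> b]" for c
    using 2[of c "\<not> c"] a na by (cases c; cases a) (auto simp: doubleton_eq_iff)
  from this[of False] this[of True]
  obtain b d where b: "\<tau> [False, True] = [b, \<not> b]" and d: "\<tau> [True, False] = [d, \<not> d]"
    by auto
  have "d = (\<not> b)"
    using inj[of "[False, True]" "[True, False]"] b d by (cases b) auto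
  then consider "\<not> a" "\<not> b" "d" | "\<not> a" "b" "\<not> d" | "a" "b" "\<not> d" | "a" "\<not> b" "d" by blast
  then show ?thesis
  proof cases
    case 1
    then have "\<tau> = id" using a na const b d by (intro short deletion_automorphism_id) auto
    then show ?thesis by blast
  next
    case 2
    then have "\<tau> = rev" using a na const b d by (intro short deletion_automorphism_rev) auto
    then show ?thesis by blast
  next
    case 3
    then have "\<tau> = map Not" using a na const b d by (intro short deletion_automorphism_not) auto
    then show ?thesis by blast
  next
    case 4
    then have "\<tau> = rev \<circ> map Not" using a na const b d
      by (intro short deletion_automorphism_comp deletion_automorphism_rev deletion_automorphism_not) auto
    then show ?thesis by blast
  qed
qed

section \<open>Automorphisms act on bit strings\<close>

lemma shuffles_single: "w \<in> shuffles [x] v \<longleftrightarrow> (\<exists>p q. v = p @ q \<and> w = p @ x # q)"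
proof
  assume "w \<in> shuffles [x] v"
  then show "\<exists>p q. v = p @ q \<and> w = p @ x # q"
  proof (induction v arbitrary: w)
    case (Cons y v)
    then consider "w = x # y # v" | w' where "w = y # w'" "w' \<in> shuffles [x] v" by auto
    then show ?case
    proof cases
      case 1
      then have "y # v = [] @ y # v \<and> w = [] @ x # y # v" by simp
      then show ?thesis by blast
    next
      case (2 w')
      then obtain p q where "v = p @ q" "w' = p @ x # q" using Cons.IH by blast
      then have "y # v = (y # p) @ q \<and> w = (y # p) @ x # q" using 2 by simp
      then show ?thesis by blast
    qed
  qed simp
next
  assume "\<exists>p q. v = p @ q \<and> w = p @ x # q"
  then obtain p q where "v = p @ q" "w = p @ x # q" by blast
  moreover have "p @ x # q \<in> shuffles ([] @ [x]) (p @ q)"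
    unfolding append_in_shuffles_iff
    by (intro exI conjI refl) (auto intro: Cons_in_shuffles_leftI)
  ultimately show "w \<in> shuffles [x] v" by simp
qed

text \<open>Inserting \<open>x\<close> between \<open>y\<close> and \<open>z\<close> replaces the comparison of \<open>y\<close> with \<open>z\<close> by
  those of \<open>y\<close> with \<open>x\<close> and of \<open>x\<close> with \<open>z\<close>. At least one of them agrees with the old
  comparison, because the order is linear.\<close>

lemma descents_insert_letter:
  assumes "v \<noteq> []" "w \<in> shuffles [x] v"
  shows "descents v \<in> deletions (descents w)"
proof -
  obtain p q where pq: "v = p @ q" "w = p @ x # q" using assms(2) by (auto simp: shuffles_single)
  consider "p = []" | "p \<noteq> []" "q = []" | "p \<noteq> []" "q \<noteq> []" by blast
  then show ?thesis
  proof cases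
    case 1
    then show ?thesis using pq assms(1) by (cases q) auto
  next
    case 2
    then have "descents w = descents v @ (x < last p) # []" "descents v = descents v @ []"
      using pq by (simp_all add: descents_append)
    then show ?thesis unfolding deletions_iff by blast
  next
    case 3
    have v: "descents v = descents p @ (hd q < last p) # descents q"
      using 3 pq by (simp add: descents_append)
    have w: "descents w = descents p @ (x < last p) # (hd q < x) # descents q"
      using 3 pq by (cases q) (simp_all add: descents_append)
    have "(hd q < last p) = (x < last p) \<or> (hd q < last p) = (hd q < x)" by auto
    then show ?thesis
    proof
      assume "(hd q < last p) = (hd q < x)"
      then show ?thesis unfolding v w deletions_iff by blast
    next
      assume *: "(hd q < last p) = (x < last p)"
      have "descents w = (descents p @ [x < last p]) @ (hd q < x) # descents q"
        "descents v = (descents p @ [x < last p]) @ descents q"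
        by (simp_all add: v w *)
      then show ?thesis unfolding deletions_iff by blast
    qed
  qed
qed

text \<open>To insert the bit \<open>c\<close> at a given place, insert a letter directly above or below the preceding
  letter. Even letters leave room for it, and its comparison with the following letter is the same as
  that of the preceding letter.\<close>

lemma ex_insertion_with_descents:
  assumes "s \<in> deletions t"
  obtains x v w where "distinct (x # v)" "v \<noteq> []" "descents v = s"
    "w \<in> shuffles [x] v" "descents w = t"
proof -
  obtain p c q where t: "t = p @ c # q" and s: "s = p @ q" using assms by (auto simp: deletions_iff)
  obtain v' where v': "v' \<noteq> []" "distinct v'" "descents v' = s" using ex_word_with_descents by blast
  define v where "v = map (\<lambda>x. 2 * x) v'"
  have v: "v \<noteq> []" "distinct v" "descents v = s" "\<And>x. x \<in> set v \<Longrightarrow> even x"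
    using v' by (auto simp: v_def distinct_map inj_on_def descents_strict_mono strict_mono_def)
  define v1 where "v1 = take (Suc (length p)) v"
  define v2 where "v2 = drop (Suc (length p)) v"
  have v12: "v = v1 @ v2" "v1 \<noteq> []" using v(1) by (simp_all add: v1_def v2_def)
  have "length v = Suc (length p + length q)"
    using length_descents[of v] v(1,3) s by (cases v) auto
  then have len: "length (descents v1) = length p" by (simp add: v1_def length_descents)
  define x where "x = last v1 + (if c then - 1 else 1)"
  have ev: "even (last v1)" using v12 v(4) by simp
  then have "odd x" by (simp add: x_def)
  then have d: "distinct (x # v)" using v by auto
  have x: "x < last v1 \<longleftrightarrow> c" by (simp add: x_def)
  have "descents (v1 @ x # v2) = t"
  proof (cases "v2 = []")
    case True
    then have "descents v1 = p @ q" using v12 v(3) s by simp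
    then have "p = descents v1" "q = []" using len by simp_all
    then show ?thesis using True v12 x t by (simp add: descents_append)
  next
    case False
    have "descents v1 @ (hd v2 < last v1) # descents v2 = p @ q"
      using v12 v(3) s False by (simp add: descents_append)
    then have pq: "p = descents v1" "q = (hd v2 < last v1) # descents v2" using len by simp_all
    have "hd v2 \<in> set v2" "last v1 \<in> set v1" using False v12 by simp_all
    then have "hd v2 \<noteq> last v1" "even (hd v2)" using v(2) v(4)[of "hd v2"] v12(1) by auto
    then have "hd v2 < x \<longleftrightarrow> hd v2 < last v1" using ev unfolding x_def by (cases c; simp; presburger)
    then show ?thesis using False v12 x pq t by (cases v2) (simp_all add: descents_append)
  qed
  moreover have "v1 @ x # v2 \<in> shuffles [x] v" using v12 by (auto simp: shuffles_single)
  ultimately show thesis using that d v by blast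
qed

text \<open>The left hand side depends only on the descents of \<open>v\<close>. So a suitable choice of the letters shows
  any given one-bit insertion into \<open>descents v\<close> among the terms on the right.\<close>

lemma box_times_fundamental:
  assumes "distinct (x # v)" "v \<noteq> []"
  shows "F [1] * F (comp_of_bits (descents v)) =
    (\<Sum>w\<in>shuffles [x] v. F (comp_of_bits (descents w)))"
proof -
  have "F [1] * F (comp_of_bits (descents v)) = F (descent_comp [x]) * F (descent_comp v)"
    using assms(2) by (simp add: descent_comp_def)
  also have "\<dots> = (\<Sum>w\<in>shuffles [x] v. F (descent_comp w))"
    using assms(1) by (intro fundamental_shuffle_product) simp
  also have "\<dots> = (\<Sum>w\<in>shuffles [x] v. F (comp_of_bits (descents w)))"
    by (intro sum.cong) (auto simp: descent_comp_def)
  finally show ?thesis .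
qed

text \<open>The grading makes the permutation of the basis a length-preserving bijection \<open>\<tau>\<close> of bit strings.
  Apply the automorphism to the expansion of \<open>F [1] * F \<alpha>\<close>: since \<open>F [1]\<close> is fixed, \<open>\<tau>\<close> maps
  the basis elements occurring there to those occurring in the product of \<open>F [1]\<close> with the image
  of \<open>F \<alpha>\<close>. So \<open>\<tau>\<close> respects deletions. For either
  direction the letters are chosen so that the given deletion shows up in one of the two expansions.\<close>

lemma fundamental_automorphism_on_bits:
  assumes "fundamental_automorphism \<phi>"
  obtains \<tau> where "deletion_automorphism \<tau>"
    "\<And>s. \<phi> (F (comp_of_bits s)) = F (comp_of_bits (\<tau> s))"
proof -
  have lin: "qsym_linear \<phi>" and inj: "inj \<phi>" and mult: "\<And>f g. \<phi> (f * g) = \<phi> f * \<phi> g"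
    and onto: "\<phi> ` (F ` compositions) = F ` compositions"
    and graded: "\<And>f n. f \<in> QSym_deg n \<Longrightarrow> \<phi> f \<in> QSym_deg n"
    using assms
    unfolding fundamental_automorphism_def algebra_automorphism_def graded_def image_subset_iff
    by (simp_all add: bij_is_inj)
  have degree: "sum_list \<beta> = sum_list \<alpha>"
    if "\<alpha> \<in> compositions" "\<beta> \<in> compositions" "\<phi> (F \<alpha>) = F \<beta>" for \<alpha> \<beta>
    using graded[of "F \<alpha>" "sum_list \<alpha>"] that by (simp add: F_in_QSym_deg_iff)
  have bits: "\<exists>t. \<beta> = comp_of_bits t \<and> length t = length s"
    if "\<beta> \<in> compositions" "sum_list \<beta> = Suc (length s)" for \<beta> and s :: "bool list"
    using that by (metis comp_of_bits_surj nat.inject sum_list.Nil old.nat.distinct(1))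
  have "\<exists>t. \<phi> (F (comp_of_bits s)) = F (comp_of_bits t) \<and> length t = length s" for s
  proof -
    obtain \<beta> where \<beta>: "\<beta> \<in> compositions" "\<phi> (F (comp_of_bits s)) = F \<beta>"
      using onto comp_of_bits_composition[of s] by blast
    then have "sum_list \<beta> = Suc (length s)"
      using degree[OF comp_of_bits_composition \<beta>] by (simp add: sum_comp_of_bits)
    then show ?thesis using bits \<beta> by blast
  qed
  then obtain \<tau> where \<tau>: "\<And>s. \<phi> (F (comp_of_bits s)) = F (comp_of_bits (\<tau> s))"
    and len: "\<And>s. length (\<tau> s) = length s"
    by metis
  have F_inject: "F (comp_of_bits s) = F (comp_of_bits t) \<longleftrightarrow> s = t" for s t
    using inj_on_eq_iff[OF inj_on_F] comp_of_bits_composition comp_of_bits_inject by simp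
  have \<tau>_inject: "\<tau> s = \<tau> t \<longleftrightarrow> s = t" for s t
    by (metis F_inject \<tau> inj injD)
  have "\<exists>s. t = \<tau> s" for t
  proof -
    obtain \<alpha> where \<alpha>: "\<alpha> \<in> compositions" "\<phi> (F \<alpha>) = F (comp_of_bits t)"
      using onto comp_of_bits_composition[of t] by (metis (no_types, lifting) imageE image_eqI)
    then have "sum_list \<alpha> = Suc (length t)"
      using degree[OF \<alpha>(1) comp_of_bits_composition \<alpha>(2)] by (simp add: sum_comp_of_bits)
    then obtain s where "\<alpha> = comp_of_bits s" using bits \<alpha>(1) by blast
    then show ?thesis using \<alpha>(2) \<tau> F_inject by metis
  qed
  then have bij: "bij \<tau>" using \<tau>_inject by (auto simp: bij_def inj_def surj_def)
  have "\<tau> [] = []" using len[of "[]"] by simp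
  \<comment> \<open>The empty bit string encodes the composition of one.\<close>
  then have box: "\<phi> (F [1]) = F [1]" using \<tau>[of "[]"] by simp
  have image: "(\<lambda>w. \<tau> (descents w)) ` shuffles [x] v = descents ` shuffles [y] v'"
    if "distinct (x # v)" "v \<noteq> []" "distinct (y # v')" "v' \<noteq> []" "descents v' = \<tau> (descents v)"
    for x v y v'
  proof -
    have "(\<Sum>w\<in>shuffles [x] v. F (comp_of_bits (\<tau> (descents w)))) =
        \<phi> (F [1] * F (comp_of_bits (descents v)))"
      by (simp only: box_times_fundamental[OF that(1,2)] qsym_linear_sum[OF lin] \<tau>)
    also have "\<dots> = F [1] * F (comp_of_bits (descents v'))"
      by (simp only: mult box \<tau> that(5))
    also have "\<dots> = (\<Sum>w\<in>shuffles [y] v'. F (comp_of_bits (descents w)))"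
      by (rule box_times_fundamental[OF that(3,4)])
    finally have "(\<lambda>w. comp_of_bits (\<tau> (descents w))) ` shuffles [x] v =
        (\<lambda>w. comp_of_bits (descents w)) ` shuffles [y] v'"
      by (intro sums_of_basis_elements_eq) (auto simp: comp_of_bits_composition)
    then have "comp_of_bits ` ((\<lambda>w. \<tau> (descents w)) ` shuffles [x] v) =
        comp_of_bits ` (descents ` shuffles [y] v')"
      by (simp only: image_image)
    then show ?thesis using inj_image_eq_iff[of comp_of_bits] by (simp add: inj_def comp_of_bits_inject)
  qed
  have word: "\<exists>x v. distinct (x # v) \<and> v \<noteq> [] \<and> descents v = s" for s
  proof -
    obtain u v where "u \<noteq> []" "v \<noteq> []" "distinct (u @ v)" "descents v = s"
      using ex_word_pair_with_descents by blast
    then show ?thesis by (cases u) auto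
  qed
  have "\<tau> s \<in> deletions (\<tau> t) \<longleftrightarrow> s \<in> deletions t" for s t
  proof
    assume "\<tau> s \<in> deletions (\<tau> t)"
    then obtain y v' w' where v': "distinct (y # v')" "v' \<noteq> []" "descents v' = \<tau> s"
      and w': "w' \<in> shuffles [y] v'" "descents w' = \<tau> t"
      by (rule ex_insertion_with_descents)
    obtain x v where v: "distinct (x # v)" "v \<noteq> []" "descents v = s" using word by blast
    have "\<tau> t \<in> (\<lambda>w. \<tau> (descents w)) ` shuffles [x] v"
      using image[OF v(1,2) v'(1,2)] v(3) v'(3) w' by (metis image_eqI)
    then obtain w where "w \<in> shuffles [x] v" "\<tau> t = \<tau> (descents w)" by (rule imageE)
    then have "w \<in> shuffles [x] v" "descents w = t" by (simp_all only: \<tau>_inject)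
    then show "s \<in> deletions t" using descents_insert_letter[of v w x] v by simp
  next
    assume "s \<in> deletions t"
    then obtain x v w where v: "distinct (x # v)" "v \<noteq> []" "descents v = s"
      and w: "w \<in> shuffles [x] v" "descents w = t"
      by (rule ex_insertion_with_descents)
    obtain y v' where v': "distinct (y # v')" "v' \<noteq> []" "descents v' = \<tau> s" using word by blast
    have "\<tau> t \<in> descents ` shuffles [y] v'"
      using image[OF v(1,2) v'(1,2)] v(3) v'(3) w by (metis (no_types, lifting) image_eqI)
    then obtain w' where "w' \<in> shuffles [y] v'" "\<tau> t = descents w'" by (rule imageE)
    then show "\<tau> s \<in> deletions (\<tau> t)" using descents_insert_letter[of v' w' y] v' by simp
  qed
  then have "deletion_automorphism \<tau>" using bij len by unfold_locales
  then show thesis using that \<tau> by blast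
qed

section \<open>Classification of the automorphisms\<close>

theorem proposition5p1:
  shows
    "(\<exists>!\<Psi>. qsym_linear \<Psi> \<and> (\<forall>\<alpha>\<in>compositions. \<Psi> (F \<alpha>) = F (complement \<alpha>))) \<and>
     (\<exists>!\<rho>. qsym_linear \<rho> \<and> (\<forall>\<alpha>\<in>compositions. \<rho> (F \<alpha>) = F (rev \<alpha>))) \<and>
     (\<exists>!\<omega>. qsym_linear \<omega> \<and> (\<forall>\<alpha>\<in>compositions. \<omega> (F \<alpha>) = F (transpose_comp \<alpha>))) \<and>
     (\<forall>\<Psi> \<rho> \<omega>.
        qsym_linear \<Psi> \<and> (\<forall>\<alpha>\<in>compositions. \<Psi> (F \<alpha>) = F (complement \<alpha>)) \<and>
        qsym_linear \<rho> \<and> (\<forall>\<alpha>\<in>compositions. \<rho> (F \<alpha>) = F (rev \<alpha>)) \<and>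
        qsym_linear \<omega> \<and> (\<forall>\<alpha>\<in>compositions. \<omega> (F \<alpha>) = F (transpose_comp \<alpha>)) \<longrightarrow>
        {\<phi>. algebra_automorphism \<phi> \<and> graded \<phi> \<and> \<phi> ` (F ` compositions) = F ` compositions \<and> \<phi> \<noteq> id}
          = {\<Psi>, \<rho>, \<omega>})"
proof (intro conjI ex1_qsym_linear allI impI, elim conjE)
  fix \<Psi> \<rho> \<omega>
  assume \<Psi>: "qsym_linear \<Psi>" "\<forall>\<alpha>\<in>compositions. \<Psi> (F \<alpha>) = F (complement \<alpha>)"
    and \<rho>: "qsym_linear \<rho>" "\<forall>\<alpha>\<in>compositions. \<rho> (F \<alpha>) = F (rev \<alpha>)"
    and \<omega>: "qsym_linear \<omega>" "\<forall>\<alpha>\<in>compositions. \<omega> (F \<alpha>) = F (transpose_comp \<alpha>)"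
  have auts: "fundamental_automorphism \<Psi>" "fundamental_automorphism \<rho>" "fundamental_automorphism \<omega>"
    using \<Psi> \<rho> \<omega> word_symmetry.fundamental_automorphism[OF word_symmetry_complement]
      word_symmetry.fundamental_automorphism[OF word_symmetry_rev]
      word_symmetry.fundamental_automorphism[OF word_symmetry_transpose] by blast+
  have bits: "\<Psi> (F (comp_of_bits s)) = F (comp_of_bits (map Not s))"
    "\<rho> (F (comp_of_bits s)) = F (comp_of_bits (rev s))"
    "\<omega> (F (comp_of_bits s)) = F (comp_of_bits (rev (map Not s)))" for s
    using \<Psi>(2) \<rho>(2) \<omega>(2) comp_of_bits_composition[of s]
    by (simp_all add: complement_comp_of_bits rev_comp_of_bits transpose_comp_of_bits rev_map)
  have ne: "\<phi> \<noteq> id" if "\<phi> (F (comp_of_bits s)) = F (comp_of_bits t)" "t \<noteq> s" for \<phi> s t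
    using that inj_on_eq_iff[OF inj_on_F] comp_of_bits_composition comp_of_bits_inject
    by auto
  have nontrivial: "\<Psi> \<noteq> id" "\<rho> \<noteq> id" "\<omega> \<noteq> id"
    using ne[of \<Psi> "[False]" "[True]"] ne[of \<rho> "[False, True]" "[True, False]"]
      ne[of \<omega> "[False]" "[True]"] bits(1)[of "[False]"] bits(2)[of "[False, True]"]
      bits(3)[of "[False]"]
    by simp_all
  have only: "\<phi> \<in> {\<Psi>, \<rho>, \<omega>}" if \<phi>: "fundamental_automorphism \<phi>" "\<phi> \<noteq> id" for \<phi>
  proof -
    have lin: "qsym_linear \<phi>" and one: "\<phi> 1 = 1"
      using \<phi>(1) by (simp_all add: fundamental_automorphism_def algebra_automorphism_def)
    have unique: "\<phi> = \<psi>" if "qsym_linear \<psi>" "\<psi> 1 = 1"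
      "\<And>s. \<phi> (F (comp_of_bits s)) = \<psi> (F (comp_of_bits s))" for \<psi>
    proof (rule qsym_linear_eqI[OF lin that(1)])
      fix \<alpha> assume "\<alpha> \<in> compositions"
      then show "\<phi> (F \<alpha>) = \<psi> (F \<alpha>)"
        by (rule composition_cases) (use that one in \<open>auto simp: F_Nil\<close>)
    qed
    obtain \<tau> where \<tau>: "deletion_automorphism \<tau>"
      "\<And>s. \<phi> (F (comp_of_bits s)) = F (comp_of_bits (\<tau> s))"
      using fundamental_automorphism_on_bits[OF \<phi>(1)] by blast
    have ones: "\<Psi> 1 = 1" "\<rho> 1 = 1" "\<omega> 1 = 1"
      using auts by (simp_all add: fundamental_automorphism_def algebra_automorphism_def)
    have "\<tau> \<noteq> id"
    proof
      assume "\<tau> = id"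
      then have "\<phi> = id" using \<tau>(2) by (intro unique) (simp_all add: qsym_linear_iff)
      then show False using \<phi>(2) by simp
    qed
    then consider "\<tau> = map Not" | "\<tau> = rev" | "\<tau> = rev \<circ> map Not"
      using deletion_automorphism_cases[OF \<tau>(1)] by blast
    then show ?thesis
    proof cases
      case 1
      then have "\<phi> = \<Psi>" using \<tau>(2) \<Psi>(1) ones bits by (intro unique) simp_all
      then show ?thesis by simp
    next
      case 2
      then have "\<phi> = \<rho>" using \<tau>(2) \<rho>(1) ones bits by (intro unique) simp_all
      then show ?thesis by simp
    next
      case 3
      then have "\<phi> = \<omega>" using \<tau>(2) \<omega>(1) ones bits by (intro unique) simp_all
      then show ?thesis by simp
    qed
  qed
  have "{\<phi>. algebra_automorphism \<phi> \<and> graded \<phi> \<and> \<phi> ` (F ` compositions) = F ` compositions \<and> \<phi> \<noteq> id} =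
      {\<phi>. fundamental_automorphism \<phi> \<and> \<phi> \<noteq> id}"
    by (simp add: fundamental_automorphism_def)
  also have "\<dots> = {\<Psi>, \<rho>, \<omega>}" using auts nontrivial only by blast
  finally show "{\<phi>. algebra_automorphism \<phi> \<and> graded \<phi> \<and> \<phi> ` (F ` compositions) = F ` compositions \<and> \<phi> \<noteq> id} =
      {\<Psi>, \<rho>, \<omega>}" .
qed

end
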